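(* Let $\sigma_0>0$, $S_0>0$, and let $\sigma_{\rm BS}(T)$, $T>0$, be the at-the-money Black-Scholes implied volatility in the uncorrelated log-normal ($\beta=1$) SABR model with $\omega=1$. Then the short-maturity expansion of the implied volatility is asymptotic and non-convergent: as $T\to 0^+$, $\sigma_{\rm BS}(T)$ has an asymptotic expansion in powers of $T$, $\sigma_{\rm BS}(T)\sim\sum_{k=0}^\infty b_k T^k$, and the power series $\sum_{k\ge 0} b_k T^k$ has zero radius of convergence. The same holds for the short-maturity expansion of $(\sigma_{\rm BS}(T)/\sigma_0)^2$ in powers of $T$.
   Context: The uncorrelated log-normal SABR model with $\omega=1$: $dS_t=\sigma_t S_t\,dW_t$, $d\sigma_t=\sigma_t\,dZ_t$, with $W,Z$ independent standard Brownian motions and deterministic initial values $S_0>0$, $\sigma_0>0$. The at-the-money (strike $K=S_0$) call price is $C(T)=\mathbb{E}[(S_T-S_0)^+]$. It is given by the exact representation (known, taken as the starting point) $$C(T)=\frac{2S_0e^{-T/8}}{\pi^{3/2}\sqrt{T}}\int_0^\infty e^{-\frac{u^2}{2T}}g(u)\,du,\qquad g(u)=\sinh u\int_0^u\frac{h(s)}{\sqrt{\cosh u-\cosh s}}\,ds\quad(u>0),$$ $$h(s)=\frac{\sin(\frac{\sigma_0}{2}\sinh s)}{\sinh s},\quad h(0)=\frac{\sigma_0}{2}.$$ The implied volatility $\sigma_{\rm BS}(T)>0$ is the unique solution of $C(T)=S_0\,\mathrm{Erf}\!\left(\frac{\sigma_{\rm BS}(T)\sqrt{T}}{2\sqrt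 2}\right)$, where $\mathrm{Erf}(x)=\frac{2}{\sqrt\pi}\int_0^x e^{-t^2}dt$. The notation $f(T)\sim\sum_k c_kT^k$ as $T\to0^+$ means that for every $N$, $f(T)-\sum_{k=0}^N c_kT^k=O(T^{N+1})$. *)

theory Defs
  imports "HOL-Analysis.Analysis" "HOL-Library.Landau_Symbols"
begin

definition Erf :: "real \<Rightarrow> real" where
  "Erf x = 2 / sqrt pi * (LBINT t=0..x. exp (- (t\<^sup>2)))"

definition sabr_h :: "real \<Rightarrow> real \<Rightarrow> real" where
  "sabr_h \<sigma>\<^sub>0 s = (if s = 0 then \<sigma>\<^sub>0 / 2 else sin (\<sigma>\<^sub>0 / 2 * sinh s) / sinh s)"

definition sabr_g :: "real \<Rightarrow> real \<Rightarrow> real" where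
  "sabr_g \<sigma>\<^sub>0 u = sinh u * (LBINT s:{0<..<u}. sabr_h \<sigma>\<^sub>0 s / sqrt (cosh u - cosh s))"

(* The at-the-money call price E[max (S_T - S_0) 0] in the model
     dS_t = sigma_t S_t dW_t,   d sigma_t = sigma_t dZ_t,
   with W, Z independent standard Brownian motions and initial values
   S_0 = S\<^sub>0, sigma_0 = \<sigma>\<^sub>0, given by its known exact integral representation. *)
definition sabr_atm_call :: "real \<Rightarrow> real \<Rightarrow> real \<Rightarrow> real" where
  "sabr_atm_call S\<^sub>0 \<sigma>\<^sub>0 T =
     2 * S\<^sub>0 * exp (- T / 8) / (pi powr (3/2) * sqrt T) *
       (LBINT u:{0<..}. exp (- (u\<^sup>2) / (2 * T)) * sabr_g \<sigma>\<^sub>0 u)"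

(* S\<^sub>0 * Erf (v * sqrt T / (2 * sqrt 2)) is the Black-Scholes price, at zero rates, of the
   at-the-money call with volatility v.
   Erf is strictly increasing, so for T > 0 and S\<^sub>0 > 0 there is at most one such v;
   it exists precisely when 0 < sabr_atm_call S\<^sub>0 \<sigma>\<^sub>0 T < S\<^sub>0. *)
definition sabr_implied_vol :: "real \<Rightarrow> real \<Rightarrow> real \<Rightarrow> real" where
  "sabr_implied_vol S\<^sub>0 \<sigma>\<^sub>0 T =
     (THE v. v > 0 \<and> sabr_atm_call S\<^sub>0 \<sigma>\<^sub>0 T = S\<^sub>0 * Erf (v * sqrt T / (2 * sqrt 2)))"

definition asymptotic_power_series_at_0_right ::
    "(real \<Rightarrow> real) \<Rightarrow> (nat \<Rightarrow> real) \<Rightarrow> bool" where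
  "asymptotic_power_series_at_0_right f c \<longleftrightarrow>
     (\<forall>N. (\<lambda>T. f T - (\<Sum>k\<le>N. c k * T ^ k)) \<in> O[at_right 0](\<lambda>T. T ^ (N + 1)))"

end

theory Submission
  imports Defs "HOL-Complex_Analysis.Complex_Analysis" "HOL-Probability.Distributions"
    "HOL-Real_Asymp.Real_Asymp"
begin

text \<open>
  The substitution \<open>sinh (s / 2) = sinh (u / 2) * sin \<phi>\<close> turns \<open>g\<close> into \<open>sinh u\<close> times an integral over
  \<open>[0, pi/2]\<close> of a kernel depending analytically on \<open>u\<close>. Hence \<open>g\<close> extends to an odd holomorphic function
  on the strip \<open>\<bar>Im u\<bar> < pi\<close>, and by Watson's lemma \<open>e\<^sup>T\<^sup>/\<^sup>8 C(T) / sqrt T\<close> has an asymptotic expansion whose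
  \<open>k\<close>-th coefficient is a constant times \<open>k! 2\<^sup>k g\<^sub>k\<close>, where \<open>g\<^sub>k\<close> is the Taylor coefficient of \<open>u\<^sup>2\<^sup>k\<^sup>+\<^sup>1\<close>.
  On the imaginary axis the integral diverges logarithmically at \<open>\<i> * pi\<close>, so \<open>g\<close> is not entire and the
  factorials cannot be compensated: that expansion diverges.

  Write \<open>Erf x = x * E(x\<^sup>2)\<close> with \<open>E\<close> entire and \<open>A(T) = C(T) / (S\<^sub>0 * sqrt T)\<close>. The implied volatility \<open>v\<close>
  solves the fixed-point equation \<open>v = 2 * sqrt 2 * A(T) / E(v\<^sup>2 * T / 8)\<close>, each iteration of which gains one order
  in \<open>T\<close>; this gives the expansion of \<open>v\<close>. Conversely \<open>A(T)\<^sup>2 = v\<^sup>2 / 8 * E(v\<^sup>2 * T / 8)\<^sup>2\<close>, so a convergent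
  expansion of \<open>v\<close> or \<open>v\<^sup>2\<close> would make the expansion of \<open>A\<close> convergent.
\<close>

subsection \<open>Analytic functions as asymptotic approximants\<close>

text \<open>Approximants are analytic germs rather than polynomials, so products and compositions
  need no truncation and no coefficient formulas. For \<open>N = 0\<close> the condition on
  \<open>f\<close> is just boundedness near 0.\<close>

definition agrees_upto :: "nat \<Rightarrow> (real \<Rightarrow> complex) \<Rightarrow> (complex \<Rightarrow> complex) \<Rightarrow> bool" where
  "agrees_upto N f h \<longleftrightarrow> h analytic_on {0} \<and>
     (\<lambda>T. f T - h (of_real T)) \<in> O[at_right 0](\<lambda>T. of_real (T ^ N))"

lemma filterlim_of_real_at_right_0:
  "filterlim (of_real :: real \<Rightarrow> complex) (nhds 0) (at_right 0)"
  using tendsto_of_real[OF tendsto_ident_at[of 0 "{0<..}"]] by simp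

lemma analytic_tendsto_at_right_0:
  assumes "h analytic_on {0::complex}"
  shows "((\<lambda>T. h (of_real T)) \<longlongrightarrow> h 0) (at_right (0::real))"
proof -
  have "isCont h 0"
    using assms analytic_at_imp_isCont by blast
  then show ?thesis
    using isCont_tendsto_compose[OF _ filterlim_of_real_at_right_0] by blast
qed

lemma of_real_power_bigo_mono:
  assumes "m \<le> n"
  shows "(\<lambda>T. complex_of_real (T ^ n)) \<in> O[at_right 0](\<lambda>T. of_real (T ^ m))"
proof (rule landau_o.big_mono)
  have "eventually (\<lambda>T::real. T > 0 \<and> T < 1) (at_right 0)"
    using eventually_at_right_real[of 0 "1::real"] by (auto elim: eventually_mono)
  then show "\<forall>\<^sub>F x in at_right 0. norm (complex_of_real (x ^ n)) \<le> norm (complex_of_real (x ^ m))"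
    by eventually_elim (simp add: assms norm_power power_decreasing)
qed

lemma analytic_bigo_1:
  assumes "h analytic_on {0::complex}"
  shows "(\<lambda>T. h (of_real T)) \<in> O[at_right (0::real)](\<lambda>_. 1)"
  using analytic_tendsto_at_right_0[OF assms] by (intro bigoI_tendsto[of _ _ "h 0"]) auto

lemma agrees_upto_bigo_1:
  assumes "agrees_upto N f h"
  shows "f \<in> O[at_right 0](\<lambda>_. 1)"
proof -
  have "(\<lambda>T. f T - h (of_real T)) \<in> O[at_right 0](\<lambda>T. of_real (T ^ N))"
    using assms by (simp add: agrees_upto_def)
  also have "(\<lambda>T. complex_of_real (T ^ N)) \<in> O[at_right 0](\<lambda>T. of_real (T ^ 0))"
    by (rule of_real_power_bigo_mono) simp
  finally have "(\<lambda>T. (f T - h (of_real T)) + h (of_real T)) \<in> O[at_right 0](\<lambda>_. 1)"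
    using assms analytic_bigo_1[of h] by (intro sum_in_bigo(1)) (auto simp: agrees_upto_def)
  then show ?thesis by simp
qed

lemma agrees_upto_mono:
  assumes "agrees_upto n f h" "m \<le> n"
  shows "agrees_upto m f h"
  using assms(1) landau_o.big_trans[OF _ of_real_power_bigo_mono[OF assms(2)]]
  unfolding agrees_upto_def by blast

lemma agrees_upto_analytic:
  assumes "h analytic_on {0}"
  shows "agrees_upto N (\<lambda>T. h (of_real T)) h"
  using assms by (simp add: agrees_upto_def)

lemma agrees_upto_cong:
  assumes "agrees_upto N f h" "eventually (\<lambda>T. f T = g T) (at_right 0)"
  shows "agrees_upto N g h"
proof -
  have "eventually (\<lambda>T. f T - h (of_real T) = g T - h (of_real T)) (at_right 0)"
    using assms(2) by eventually_elim simp
  from landau_o.big.in_cong[OF this] show ?thesis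
    using assms(1) by (simp add: agrees_upto_def)
qed

lemma agrees_upto_mult:
  assumes f: "agrees_upto N f h" and g: "agrees_upto N g k"
  shows "agrees_upto N (\<lambda>T. f T * g T) (\<lambda>z. h z * k z)"
proof -
  have "(\<lambda>T. f T * (g T - k (of_real T))) \<in> O[at_right 0](\<lambda>T. 1 * of_real (T ^ N))"
    using f g agrees_upto_bigo_1 by (intro landau_o.big.mult) (auto simp: agrees_upto_def)
  moreover have "(\<lambda>T. k (of_real T) * (f T - h (of_real T))) \<in> O[at_right 0](\<lambda>T. 1 * of_real (T ^ N))"
    using f g analytic_bigo_1[of k] by (intro landau_o.big.mult) (auto simp: agrees_upto_def)
  ultimately have "(\<lambda>T. f T * (g T - k (of_real T)) + k (of_real T) * (f T - h (of_real T)))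
      \<in> O[at_right 0](\<lambda>T. of_real (T ^ N))"
    by (intro sum_in_bigo(1)) auto
  moreover have "(\<lambda>T. f T * (g T - k (of_real T)) + k (of_real T) * (f T - h (of_real T)))
      = (\<lambda>T. f T * g T - h (of_real T) * k (of_real T))"
    by (auto simp: algebra_simps)
  ultimately show ?thesis
    using f g by (auto simp: agrees_upto_def intro!: analytic_intros)
qed

text \<open>The factor \<open>T\<close> raises the order by one; this gain drives the induction for
  the implied volatility.\<close>

lemma agrees_upto_times_T:
  assumes "agrees_upto N f h"
  shows "agrees_upto (Suc N) (\<lambda>T. of_real T * f T) (\<lambda>z. z * h z)"
proof -
  have "(\<lambda>T. of_real T * (f T - h (of_real T)))
      \<in> O[at_right 0](\<lambda>T. of_real T * complex_of_real (T ^ N))"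
    using assms by (intro landau_o.big.mult) (auto simp: agrees_upto_def)
  then show ?thesis
    using assms by (auto simp: agrees_upto_def algebra_simps intro!: analytic_intros)
qed

text \<open>The derivative is bounded on a smaller closed disc by compactness, and discs are convex,
  so the mean value inequality applies.\<close>

lemma analytic_locally_lipschitz:
  assumes "R analytic_on {a::complex}"
  shows "\<exists>r>0. \<exists>L. \<forall>x\<in>ball a r. \<forall>y\<in>ball a r. norm (R x - R y) \<le> L * norm (x - y)"
proof -
  obtain e where e: "e > 0" "R holomorphic_on ball a e"
    using assms by (auto simp: analytic_on_def)
  have c: "cball a (e/2) \<subseteq> ball a e" using e by auto
  have "continuous_on (cball a (e/2)) (deriv R)"
    using holomorphic_on_imp_continuous_on[OF holomorphic_deriv[OF e(2) open_ball]] c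
    by (rule continuous_on_subset)
  then have bdd: "bounded (deriv R ` cball a (e/2))"
    by (intro compact_imp_bounded compact_continuous_image compact_cball)
  obtain L where L0: "L > 0" "\<forall>x\<in>deriv R ` cball a (e/2). norm x \<le> L"
    using bounded_pos[THEN iffD1, OF bdd] by (elim exE conjE) 
  have d: "(R has_field_derivative deriv R z) (at z within ball a (e/2))" if "z \<in> ball a (e/2)" for z
    using e that zero_le_dist[of a z] by (intro has_field_derivative_at_within[OF holomorphic_derivI[OF e(2) open_ball]]) auto
  have b: "norm (deriv R z) \<le> L" if "z \<in> ball a (e/2)" for z
    using L0(2) that ball_subset_cball[of a "e/2"] by blast
  have lip: "norm (R x - R y) \<le> L * norm (x - y)" if "x \<in> ball a (e/2)" "y \<in> ball a (e/2)" for x y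
    by (rule field_differentiable_bound[OF convex_ball d b that(1) that(2)])
  show ?thesis
    using e(1) lip by (intro exI[of _ "e/2"] exI[of _ L] conjI ballI) simp_all
qed

text \<open>\<open>R\<close> is Lipschitz near \<open>h 0\<close>, so it passes on the error up to a
  constant. The limit of \<open>f\<close> is assumed because agreement of order 0 would not bring
  \<open>f\<close> into the disc where \<open>R\<close> is controlled.\<close>

lemma agrees_upto_compose:
  assumes R: "R analytic_on {h 0}" and f: "agrees_upto N f h"
    and lim: "(f \<longlongrightarrow> h 0) (at_right 0)"
  shows "agrees_upto N (\<lambda>T. R (f T)) (\<lambda>z. R (h z))"
proof -
  obtain L r where Lr: "r > 0"
    "\<forall>x\<in>ball (h 0) r. \<forall>y\<in>ball (h 0) r. norm (R x - R y) \<le> L * norm (x - y)"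
    using analytic_locally_lipschitz[OF R] by blast
  have h: "h analytic_on {0}" using f by (simp add: agrees_upto_def)
  have "eventually (\<lambda>T. f T \<in> ball (h 0) r) (at_right 0)"
    using lim Lr(1) by (auto simp: tendsto_iff dist_commute)
  moreover have "eventually (\<lambda>T. h (of_real T) \<in> ball (h 0) r) (at_right (0::real))"
    using analytic_tendsto_at_right_0[OF h] Lr(1) by (auto simp: tendsto_iff dist_commute)
  ultimately have "eventually (\<lambda>T. norm (R (f T) - R (h (of_real T)))
      \<le> L * norm (f T - h (of_real T))) (at_right 0)"
    by eventually_elim (use Lr(2) in blast)
  then have "(\<lambda>T. R (f T) - R (h (of_real T))) \<in> O[at_right 0](\<lambda>T. f T - h (of_real T))"
    by (rule bigoI)
  also have "(\<lambda>T. f T - h (of_real T)) \<in> O[at_right 0](\<lambda>T. of_real (T ^ N))"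
    using f by (simp add: agrees_upto_def)
  finally show ?thesis
    using analytic_on_compose_gen[OF h, of R "{h 0}"] R by (auto simp: agrees_upto_def o_def)
qed

lemma agrees_upto_tendsto:
  assumes "agrees_upto (Suc N) f h"
  shows "(f \<longlongrightarrow> h 0) (at_right 0)"
proof -
  have "(\<lambda>T. f T - h (of_real T)) \<in> O[at_right 0](\<lambda>T. of_real (T ^ Suc 0))"
    using agrees_upto_mono[OF assms, of "Suc 0"] by (simp add: agrees_upto_def)
  moreover have "(\<lambda>T. complex_of_real (T ^ Suc 0)) \<in> o[at_right 0](\<lambda>T. 1)"
    using filterlim_of_real_at_right_0 by (intro smalloI_tendsto) auto
  ultimately have "(\<lambda>T. f T - h (of_real T)) \<in> o[at_right 0](\<lambda>T. 1)"
    by (rule landau_o.big_small_trans)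
  then have "((\<lambda>T. f T - h (of_real T)) \<longlongrightarrow> 0) (at_right 0)"
    by (rule smalloD_tendsto[where g = "\<lambda>_. 1", simplified])
  from tendsto_add[OF this analytic_tendsto_at_right_0[of h]] show ?thesis
    using assms by (simp add: agrees_upto_def)
qed

text \<open>The lowest non-vanishing term of the difference of two approximants, if of order below \<open>N\<close>,
  is not \<open>O(T\<^sup>N)\<close>.\<close>
lemma agrees_upto_unique:
  assumes f: "agrees_upto N f h" and g: "agrees_upto N f k"
    and H: "h has_fps_expansion H" and K: "k has_fps_expansion K" and n: "n < N"
  shows "fps_nth H n = fps_nth K n"
proof (rule ccontr)
  assume neq: "fps_nth H n \<noteq> fps_nth K n"
  define D where "D = H - K"
  define m where "m = subdegree D"
  have D: "D \<noteq> 0" "fps_nth D n \<noteq> 0" using neq by (auto simp: D_def)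
  then have m: "m \<le> n" "fps_nth D m \<noteq> 0"
    unfolding m_def using subdegree_leI[of D n] nth_subdegree_nonzero[of D] by auto
  have "(\<lambda>z. h z - k z) has_fps_expansion D"
    unfolding D_def by (intro has_fps_expansion_diff H K)
  then have "(\<lambda>z. h z - k z) \<sim>[nhds 0] (\<lambda>z. fps_nth D m * z ^ m)"
    unfolding m_def by (rule has_fps_expansion_imp_asymp_equiv_0)
  then have eq: "(\<lambda>T. h (of_real T) - k (of_real T)) \<sim>[at_right 0] (\<lambda>T. fps_nth D m * of_real T ^ m)"
    using filterlim_of_real_at_right_0 by (rule asymp_equiv_compose')
  have "(\<lambda>T. (f T - k (of_real T)) - (f T - h (of_real T))) \<in> O[at_right 0](\<lambda>T. of_real (T ^ N))"
    using f g by (intro sum_in_bigo(2)[of "\<lambda>T. f T - k (of_real T)"]) (simp_all add: agrees_upto_def)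
  then have "(\<lambda>T. h (of_real T) - k (of_real T)) \<in> O[at_right 0](\<lambda>T. of_real (T ^ N))"
    by simp
  with bigthetaD1[OF asymp_equiv_imp_bigtheta[OF asymp_equiv_symI[OF eq]]]
  have "(\<lambda>T. fps_nth D m * complex_of_real T ^ m) \<in> O[at_right 0](\<lambda>T. of_real (T ^ N))"
    by (rule landau_o.big_trans)
  then have "(\<lambda>T. complex_of_real T ^ m) \<in> O[at_right 0](\<lambda>T. of_real (T ^ N))"
    using m by simp
  also have "(\<lambda>T. complex_of_real (T ^ N)) \<in> O[at_right 0](\<lambda>T. of_real (T ^ Suc m))"
    using m n by (intro of_real_power_bigo_mono) simp
  also have "(\<lambda>T. complex_of_real (T ^ Suc m)) \<in> o[at_right 0](\<lambda>T. of_real T ^ m)"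
  proof -
    have "(\<lambda>T. complex_of_real T) \<in> o[at_right 0](\<lambda>T. 1)"
      using filterlim_of_real_at_right_0 by (intro smalloI_tendsto) auto
    then have "(\<lambda>T. complex_of_real T * complex_of_real T ^ m) \<in> o[at_right 0](\<lambda>T. 1 * of_real T ^ m)"
      by (intro landau_o.small_big_mult) auto
    then show ?thesis by simp
  qed
  \<comment> \<open>A function that is \<open>o\<close> of itself vanishes eventually, which a power
    of \<open>T > 0\<close> does not.\<close>
  finally have "eventually (\<lambda>T::real. complex_of_real T ^ m = 0) (at_right 0)"
    by (simp add: landau_o.small_refl_iff)
  moreover have "eventually (\<lambda>T::real. T > 0) (at_right 0)"
    by (simp add: eventually_at_right_less)
  ultimately have "eventually (\<lambda>T::real. False) (at_right 0)"
    by eventually_elim auto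
  then show False by simp
qed

section \<open>From analytic approximants to asymptotic power series and back\<close>

lemma fps_sum_has_expansion:
  fixes c :: "nat \<Rightarrow> complex"
  shows "(\<lambda>z. \<Sum>k\<le>N. c k * z ^ k) has_fps_expansion Abs_fps (\<lambda>k. if k \<le> N then c k else 0)"
proof -
  have "(\<lambda>z. \<Sum>k\<le>N. c k * z ^ k) has_fps_expansion (\<Sum>k\<le>N. fps_const (c k) * fps_X ^ k)"
    by (intro fps_expansion_intros)
  also have "(\<Sum>k\<le>N. fps_const (c k) * fps_X ^ k) = Abs_fps (\<lambda>k. if k \<le> N then c k else 0)"
    by (intro fps_ext) (simp add: fps_sum_nth fps_X_power_nth if_distrib[of "(*) _"] cong: if_cong)
  finally show ?thesis .
qed

text \<open>The bridge between real expansions and complex germs. The partial sum includes the term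
  of index \<open>N\<close>, hence the order \<open>Suc N\<close>.\<close>

lemma asymptotic_power_series_iff_agrees_upto:
  "asymptotic_power_series_at_0_right f c \<longleftrightarrow>
     (\<forall>N. agrees_upto (Suc N) (\<lambda>T. of_real (f T)) (\<lambda>z. \<Sum>k\<le>N. of_real (c k) * z ^ k))"
proof -
  have "(\<lambda>T. f T - (\<Sum>k\<le>N. c k * T ^ k)) \<in> O[at_right 0](\<lambda>T. T ^ (N + 1)) \<longleftrightarrow>
    agrees_upto (Suc N) (\<lambda>T. of_real (f T)) (\<lambda>z. \<Sum>k\<le>N. of_real (c k) * z ^ k)" for N
  proof -
    have "complex_of_real (f T) - (\<Sum>k\<le>N. of_real (c k) * of_real T ^ k)
        = of_real (f T - (\<Sum>k\<le>N. c k * T ^ k))" for T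
      by simp
    then have "agrees_upto (Suc N) (\<lambda>T. of_real (f T)) (\<lambda>z. \<Sum>k\<le>N. of_real (c k) * z ^ k)
      \<longleftrightarrow> (\<lambda>T. complex_of_real (f T - (\<Sum>k\<le>N. c k * T ^ k))) \<in> O[at_right 0](\<lambda>T. of_real (T ^ Suc N))"
      unfolding agrees_upto_def
      using has_fps_expansion_imp_analytic_0[OF fps_sum_has_expansion[where c = "\<lambda>k. of_real (c k)"]]
      by simp
    also have "\<dots> \<longleftrightarrow> (\<lambda>T. f T - (\<Sum>k\<le>N. c k * T ^ k)) \<in> O[at_right 0](\<lambda>T. T ^ (N + 1))"
      unfolding Suc_eq_plus1 by (rule landau_o.big.of_real_iff)
    finally show ?thesis ..
  qed
  then show ?thesis by (auto simp: asymptotic_power_series_at_0_right_def)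
qed

lemma has_fps_expansion_bigo:
  assumes h: "h has_fps_expansion F" and z: "\<And>n. n < N \<Longrightarrow> fps_nth F n = 0"
  shows "(\<lambda>T. h (complex_of_real T)) \<in> O[at_right 0](\<lambda>T. of_real (T ^ N))"
proof -
  have "(\<lambda>T. h (of_real T)) \<sim>[at_right 0] (\<lambda>T. fps_nth F (subdegree F) * complex_of_real T ^ subdegree F)"
    using has_fps_expansion_imp_asymp_equiv_0[OF h] filterlim_of_real_at_right_0
    by (rule asymp_equiv_compose')
  then have "(\<lambda>T. h (of_real T)) \<in> O[at_right 0](\<lambda>T. fps_nth F (subdegree F) * complex_of_real T ^ subdegree F)"
    by (rule asymp_equiv_imp_bigo)
  also have "(\<lambda>T. fps_nth F (subdegree F) * complex_of_real T ^ subdegree F) \<in> O[at_right 0](\<lambda>T. of_real (T ^ N))"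
  \<comment> \<open>\<open>subdegree 0\<close> is 0 by convention, but then the coefficient in front
    is zero as well.\<close>
  proof (cases "F = 0")
    case False
    then have "N \<le> subdegree F" using z nth_subdegree_nonzero[of F] by (metis not_le_imp_less)
    then show ?thesis using of_real_power_bigo_mono[of N "subdegree F"] by simp
  qed simp
  finally show ?thesis .
qed

text \<open>Only Taylor coefficients below \<open>N\<close> matter, so a germ may be exchanged for
  its Taylor polynomial, or a partial sum for the full convergent series.\<close>

lemma agrees_upto_transfer:
  assumes f: "agrees_upto N f h" and H: "h has_fps_expansion H" and K: "k has_fps_expansion K"
    and eq: "\<And>n. n < N \<Longrightarrow> fps_nth H n = fps_nth K n"
  shows "agrees_upto N f k"
proof -
  have fh: "(\<lambda>T. f T - h (of_real T)) \<in> O[at_right 0](\<lambda>T. of_real (T ^ N))"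
    using f unfolding agrees_upto_def by blast
  have hk: "(\<lambda>T. h (of_real T) - k (of_real T)) \<in> O[at_right 0](\<lambda>T. of_real (T ^ N))"
    by (rule has_fps_expansion_bigo[OF has_fps_expansion_diff[OF H K]]) (simp add: eq)
  have "(\<lambda>T. (f T - h (of_real T)) + (h (of_real T) - k (of_real T))) \<in> O[at_right 0](\<lambda>T. of_real (T ^ N))"
    by (rule sum_in_bigo(1)[OF fh hk])
  then have fk: "(\<lambda>T. f T - k (of_real T)) \<in> O[at_right 0](\<lambda>T. of_real (T ^ N))"
    unfolding add_diff_eq diff_add_cancel .
  show ?thesis
    unfolding agrees_upto_def by (rule conjI[OF has_fps_expansion_imp_analytic_0[OF K] fk])
qed

text \<open>The approximants may vary with \<open>N\<close>, but uniqueness makes their coefficients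
  compatible, so together they define one formal series.\<close>

lemma agrees_upto_imp_asymptotic_power_series:
  fixes f :: "real \<Rightarrow> real"
  assumes "\<And>N. \<exists>h. agrees_upto N (\<lambda>T. of_real (f T)) h"
  shows "\<exists>c. asymptotic_power_series_at_0_right f c"
proof -
  let ?f = "\<lambda>T. complex_of_real (f T)"
  have "\<forall>N. \<exists>h. agrees_upto (Suc N) ?f h"
    using assms by (intro allI)
  from choice[OF this] obtain h where h0: "\<forall>N. agrees_upto (Suc N) ?f (h N)"
    by (elim exE)
  note h = h0[rule_format]
  define H where "H N = fps_expansion (h N) 0" for N
  have H: "h N has_fps_expansion H N" for N
    using h[of N] analytic_at_imp_has_fps_expansion_0 by (auto simp: agrees_upto_def H_def)
  \<comment> \<open>The diagonal choice: \<open>h k\<close> agrees to order \<open>Suc k\<close>,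
    just enough to determine the coefficient of index \<open>k\<close>.\<close>
  define C where "C k = fps_nth (H k) k" for k
  have C: "fps_nth (H N) k = C k" if "k \<le> N" for k N
    unfolding C_def
    by (rule agrees_upto_unique[OF agrees_upto_mono[OF h[of N], of "Suc k"] h[of k] H H])
      (use that in auto)
  have "(\<lambda>T. f T - (\<Sum>k\<le>N. Re (C k) * T ^ k)) \<in> O[at_right 0](\<lambda>T. T ^ (N + 1))" for N
  proof -
    have "agrees_upto (Suc N) ?f (\<lambda>z. \<Sum>k\<le>N. C k * z ^ k)"
      by (rule agrees_upto_transfer[OF h[of N] H fps_sum_has_expansion]) (auto simp: C)
    then have "(\<lambda>T. ?f T - (\<Sum>k\<le>N. C k * of_real T ^ k)) \<in> O[at_right 0](\<lambda>T. complex_of_real (T ^ Suc N))"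
      by (simp add: agrees_upto_def)
    then have "(\<lambda>T. norm (?f T - (\<Sum>k\<le>N. C k * of_real T ^ k))) \<in> O[at_right 0](\<lambda>T. norm (complex_of_real (T ^ Suc N)))"
      by (simp only: landau_o.big.norm_iff)
    then have "(\<lambda>T. norm (?f T - (\<Sum>k\<le>N. C k * of_real T ^ k))) \<in> O[at_right 0](\<lambda>T. T ^ Suc N)"
      unfolding norm_of_real landau_o.big.abs .
    \<comment> \<open>Since \<open>f\<close> is real, taking real parts can only shrink the error,
      so the \<open>C k\<close> need not be shown to be real.\<close>
    moreover have "(\<lambda>T. f T - (\<Sum>k\<le>N. Re (C k) * T ^ k)) \<in> O[at_right 0](\<lambda>T. norm (?f T - (\<Sum>k\<le>N. C k * of_real T ^ k)))"
    proof (rule landau_o.big_mono, rule always_eventually, rule allI)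
      fix T
      have "f T - (\<Sum>k\<le>N. Re (C k) * T ^ k) = Re (?f T - (\<Sum>k\<le>N. C k * of_real T ^ k))"
        by (simp flip: of_real_power)
      then show "norm (f T - (\<Sum>k\<le>N. Re (C k) * T ^ k)) \<le> norm (norm (?f T - (\<Sum>k\<le>N. C k * of_real T ^ k)))"
        by (simp only: real_norm_def abs_norm_cancel abs_Re_le_cmod)
    qed
    ultimately show ?thesis unfolding Suc_eq_plus1 by (rule landau_o.big_trans[rotated])
  qed
  then show ?thesis
    unfolding asymptotic_power_series_at_0_right_def by (intro exI[of _ "\<lambda>k. Re (C k)"] allI)
qed

text \<open>A positive radius lets the series be summed to a single germ that serves every order at
  once; the divergence proof refutes such a germ.\<close>

lemma convergent_asymptotic_power_series_imp_agrees_upto: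
  assumes f: "asymptotic_power_series_at_0_right f c" and r: "conv_radius c \<noteq> 0"
  shows "\<exists>h. \<forall>N. agrees_upto N (\<lambda>T. of_real (f T)) h"
proof -
  define F where "F = Abs_fps (\<lambda>k. complex_of_real (c k))"
  have "conv_radius (\<lambda>k. complex_of_real (c k)) = conv_radius c"
    using conv_radius_norm[of "\<lambda>k. complex_of_real (c k)"] conv_radius_norm[of c]
    by (simp only: norm_of_real real_norm_def)
  then have "fps_conv_radius F > 0"
    using r conv_radius_nonneg[of c] by (simp add: F_def fps_conv_radius_def)
  then have F: "eval_fps F has_fps_expansion F" by (rule eval_fps_has_fps_expansion)
  have "agrees_upto N (\<lambda>T. of_real (f T)) (eval_fps F)" for N
  proof -
    have "agrees_upto (Suc N) (\<lambda>T. of_real (f T)) (eval_fps F)"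
      using f unfolding asymptotic_power_series_iff_agrees_upto
      by (intro agrees_upto_transfer[OF _ fps_sum_has_expansion F]) (auto simp: F_def)
    then show ?thesis by (rule agrees_upto_mono) simp
  qed
  then show ?thesis by blast
qed

subsection \<open>Analytic continuation of the integrand\<close>

text \<open>Polymorphic, so that the real and the complex integrand share one definition.\<close>

definition sinc_fun :: "'a::{banach,real_normed_field} \<Rightarrow> 'a" where
  "sinc_fun z = (if z = 0 then 1 else sin z / z)"

lemma sinc_fun_of_real: "sinc_fun (complex_of_real x) = of_real (sinc_fun x)"
  by (simp add: sinc_fun_def sin_of_real)

text \<open>The value 1 at 0 is \<open>deriv sin 0\<close>, the one that removes the singularity of
  \<open>sin z / z\<close>.\<close>

lemma holomorphic_on_sinc_fun: "(sinc_fun :: complex \<Rightarrow> complex) holomorphic_on A"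
proof -
  have "deriv sin (0::complex) = 1"
    using DERIV_imp_deriv[OF DERIV_sin[of "0::complex"]] by simp
  then have "(sinc_fun :: complex \<Rightarrow> complex) holomorphic_on UNIV"
    by (intro pole_theorem_open_0[where g = sin and a = 0 and f = sinc_fun and S = UNIV] holomorphic_on_sin)
      (simp_all add: sinc_fun_def)
  then show ?thesis by (rule holomorphic_on_subset) simp
qed

lemma abs_sinc_fun_le_1: "\<bar>sinc_fun (x::real)\<bar> \<le> 1"
  using abs_sin_x_le_abs_x[of x] by (auto simp: sinc_fun_def divide_simps)

lemma sinh_of_real: "sinh (complex_of_real x) = of_real (sinh x)"
  by (simp add: sinh_field_def exp_of_real flip: of_real_minus)

lemma Re_sinh: "Re (sinh z) = sinh (Re z) * cos (Im z)"
  and Im_sinh: "Im (sinh z) = cosh (Re z) * sin (Im z)"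
  by (simp_all add: sinh_field_def cosh_field_def Re_exp Im_exp field_simps)

lemma sin_squared_less_1: "cos (x::real) \<noteq> 0 \<Longrightarrow> (sin x)\<^sup>2 < 1"
  by (simp add: sin_squared_eq)

text \<open>With \<open>n = sinh (s / 2)\<close> one has \<open>cosh (s / 2) = sqrt (1 + n\<^sup>2)\<close> and
  \<open>sinh s = 2 * n * sqrt (1 + n\<^sup>2)\<close>, so this is \<open>2 / \<sigma> * h(s) / cosh (s / 2)\<close>.\<close>
definition ray_kernel :: "real \<Rightarrow> complex \<Rightarrow> complex" where
  "ray_kernel \<sigma> n = sinc_fun (of_real \<sigma> * n * csqrt (1 + n\<^sup>2)) / csqrt (1 + n\<^sup>2)"

text \<open>The plane without the imaginary rays from \<open>\<i>\<close> upwards and from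
  \<open>- \<i>\<close> downwards: there \<open>1 + n ^ 2\<close> avoids the branch cut of
  \<open>csqrt\<close>, including the zero of the denominator.\<close>

definition kernel_dom :: "complex set" where
  "kernel_dom = (\<lambda>n. 1 + n\<^sup>2) -` (- \<real>\<^sub>\<le>\<^sub>0)"

lemma open_kernel_dom: "open kernel_dom"
  unfolding kernel_dom_def
  by (intro open_vimage open_Compl closed_nonpos_Reals_complex continuous_intros)

lemma holomorphic_on_ray_kernel: "ray_kernel \<sigma> holomorphic_on kernel_dom"
proof -
  have root: "(\<lambda>n. csqrt (1 + n\<^sup>2)) holomorphic_on kernel_dom"
    by (intro holomorphic_intros) (auto simp: kernel_dom_def)
  have "(sinc_fun \<circ> (\<lambda>n. of_real \<sigma> * n * csqrt (1 + n\<^sup>2))) holomorphic_on kernel_dom"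
    by (rule holomorphic_on_compose[OF _ holomorphic_on_sinc_fun]) (intro holomorphic_intros root)
  moreover have "csqrt (1 + n\<^sup>2) \<noteq> 0" if "n \<in> kernel_dom" for n
    using that by (auto simp: kernel_dom_def)
  ultimately show ?thesis
    unfolding ray_kernel_def o_def by (intro holomorphic_on_divide root) auto
qed

text \<open>The map \<open>sinh (z / 2)\<close> sends the boundary lines into the rays that
  \<open>kernel_dom\<close> leaves out.\<close>

definition strip :: "complex set" where "strip = {z. \<bar>Im z\<bar> < pi}"

lemma open_strip: "open strip"
  unfolding strip_def by (intro open_Collect_less continuous_intros)

lemma convex_strip: "convex strip"
proof -
  have "strip = {z. Im z < pi} \<inter> {z. Im z > - pi}"
    by (auto simp: strip_def)
  then show ?thesis
    using convex_halfspace_Im_lt convex_halfspace_Im_gt by (metis convex_Int)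
qed

lemma of_real_in_strip [simp]: "of_real x \<in> strip"
  by (simp add: strip_def)

text \<open>A point outside \<open>kernel_dom\<close> is purely imaginary of modulus at least 1. In
  the strip \<open>cos y > 0\<close>, so a vanishing real part forces \<open>x = 0\<close>, and then
  the modulus is at most \<open>|sin y| < 1\<close>.\<close>

lemma sinh_half_in_kernel_dom:
  assumes z: "z \<in> strip" and r: "0 \<le> r" "r \<le> (1::real)"
  shows "sinh (z / 2) * of_real r \<in> kernel_dom"
proof (rule ccontr)
  define n where "n = sinh (z / 2) * of_real r"
  define x y where "x = Re z / 2" and "y = Im z / 2"
  assume "sinh (z / 2) * of_real r \<notin> kernel_dom"
  then have "1 + n\<^sup>2 \<in> \<real>\<^sub>\<le>\<^sub>0" by (simp add: kernel_dom_def n_def)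
  then have le: "1 + (Re n)\<^sup>2 - (Im n)\<^sup>2 \<le> 0" and im: "Re n * Im n = 0"
    by (auto simp: complex_nonpos_Reals_iff power2_eq_square)
  have n: "Re n = r * (sinh x * cos y)" "Im n = r * (cosh x * sin y)"
    by (simp_all add: n_def x_def y_def Re_sinh Im_sinh)
  have y: "\<bar>y\<bar> < pi / 2" using z by (simp add: strip_def y_def)
  then have cos: "cos y > 0" by (intro cos_gt_zero_pi) auto
  have sin: "\<bar>sin y\<bar> < 1"
    using cos sin_squared_less_1[of y] by (simp add: abs_square_less_1)
  have "Im n \<noteq> 0" using le by (smt (verit) zero_le_power2 power_zero_numeral)
  with im have "Re n = 0" "r \<noteq> 0" using n by auto
  with n cos have "x = 0" by auto
  then have "\<bar>Im n\<bar> \<le> \<bar>sin y\<bar>" using n r by (simp add: abs_mult mult_left_le_one_le)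
  then have "(Im n)\<^sup>2 < 1" using sin by (simp add: abs_square_less_1)
  with le show False by (smt (verit) zero_le_power2)
qed

definition sabr_kernel_integral :: "real \<Rightarrow> complex \<Rightarrow> complex" where
  "sabr_kernel_integral \<sigma> z = integral {0..pi/2} (\<lambda>\<phi>. ray_kernel \<sigma> (sinh (z / 2) * of_real (sin \<phi>)))"

definition sabr_g_complex :: "real \<Rightarrow> complex \<Rightarrow> complex" where
  "sabr_g_complex \<sigma> z = of_real (\<sigma> / sqrt 2) * sinh z * sabr_kernel_integral \<sigma> z"

lemma sin_in_unit: "\<phi> \<in> {0..pi/2} \<Longrightarrow> 0 \<le> sin \<phi> \<and> sin \<phi> \<le> 1"
  by (auto intro!: sin_ge_zero)

lemma continuous_on_kernel_arg:
  "continuous_on (strip \<times> {0..pi/2}) (\<lambda>p. sinh (fst p / 2) * complex_of_real (sin (snd p)))"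
  by (intro continuous_intros) auto

text \<open>Differentiation under the integral sign: the argument stays in \<open>kernel_dom\<close>
  for all angles, so the derivative in \<open>z\<close> is jointly continuous.\<close>

lemma holomorphic_on_sabr_kernel_integral: "sabr_kernel_integral \<sigma> holomorphic_on strip"
proof -
  let ?w = "\<lambda>z \<phi>. sinh (z / 2) * complex_of_real (sin \<phi>)"
  have dom: "?w z \<phi> \<in> kernel_dom" if "z \<in> strip" "\<phi> \<in> {0..pi/2}" for z \<phi>
    using sinh_half_in_kernel_dom[OF that(1)] sin_in_unit[OF that(2)] by blast
  have der: "((\<lambda>z. ray_kernel \<sigma> (?w z \<phi>)) has_field_derivative
      deriv (ray_kernel \<sigma>) (?w z \<phi>) * (cosh (z / 2) * of_real (sin \<phi>) / 2)) (at z within strip)"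
    if "z \<in> strip" "\<phi> \<in> cbox 0 (pi/2)" for z \<phi>
  proof (rule DERIV_chain2[where f = "ray_kernel \<sigma>" and g = "\<lambda>z. ?w z \<phi>"])
    show "(ray_kernel \<sigma> has_field_derivative deriv (ray_kernel \<sigma>) (?w z \<phi>)) (at (?w z \<phi>))"
      using that dom by (intro holomorphic_derivI[OF holomorphic_on_ray_kernel open_kernel_dom]) auto
    show "((\<lambda>z. ?w z \<phi>) has_field_derivative cosh (z / 2) * of_real (sin \<phi>) / 2) (at z within strip)"
      by (auto intro!: derivative_eq_intros)
  qed
  have int: "(\<lambda>\<phi>. ray_kernel \<sigma> (?w z \<phi>)) integrable_on cbox 0 (pi/2)" if "z \<in> strip" for z
  proof (intro integrable_continuous)
    show "continuous_on (cbox 0 (pi/2)) (\<lambda>\<phi>. ray_kernel \<sigma> (?w z \<phi>))"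
      by (rule continuous_on_compose2[OF holomorphic_on_imp_continuous_on[OF holomorphic_on_ray_kernel]])
        (use dom that in \<open>auto intro!: continuous_intros\<close>)
  qed
  have cont: "continuous_on (strip \<times> cbox 0 (pi/2))
     (\<lambda>(z, \<phi>). deriv (ray_kernel \<sigma>) (?w z \<phi>) * (cosh (z / 2) * of_real (sin \<phi>) / 2))"
  proof -
    have "continuous_on (strip \<times> cbox 0 (pi/2)) (\<lambda>p. deriv (ray_kernel \<sigma>) (?w (fst p) (snd p)))"
      by (rule continuous_on_compose2[OF holomorphic_on_imp_continuous_on[OF
             holomorphic_deriv[OF holomorphic_on_ray_kernel open_kernel_dom]]])
        (use dom continuous_on_kernel_arg in auto)
    then show ?thesis
      unfolding case_prod_beta by (intro continuous_intros) auto
  qed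
  have "(\<lambda>z. integral (cbox 0 (pi/2)) (\<lambda>\<phi>. ray_kernel \<sigma> (?w z \<phi>))) holomorphic_on strip"
    by (rule leibniz_rule_holomorphic[OF der int cont convex_strip])
  then show ?thesis
    by (simp add: sabr_kernel_integral_def[abs_def])
qed

lemma holomorphic_on_sabr_g_complex: "sabr_g_complex \<sigma> holomorphic_on strip"
  unfolding sabr_g_complex_def[abs_def] sinh_field_def
  by (intro holomorphic_intros holomorphic_on_sabr_kernel_integral) auto

section \<open>Values on the real and on the imaginary axis\<close>

definition real_kernel :: "real \<Rightarrow> real \<Rightarrow> real" where
  "real_kernel \<sigma> x = sinc_fun (\<sigma> * x * sqrt (1 + x\<^sup>2)) / sqrt (1 + x\<^sup>2)"

text \<open>For \<open>|m| < 1\<close> this is \<open>ray_kernel\<close> at \<open>\<i> * m\<close>,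
  where the sine becomes a hyperbolic sine. The zero of \<open>sqrt (1 - m ^ 2)\<close> at
  \<open>m = 1\<close> causes the singularity at \<open>\<i> * pi\<close>.\<close>

definition imag_kernel :: "real \<Rightarrow> real \<Rightarrow> real" where
  "imag_kernel \<sigma> m = (let y = \<sigma> * m * sqrt (1 - m\<^sup>2) in (if y = 0 then 1 else sinh y / y)) / sqrt (1 - m\<^sup>2)"

lemma ray_kernel_of_real: "ray_kernel \<sigma> (of_real x) = of_real (real_kernel \<sigma> x)"
proof -
  have "csqrt (1 + (of_real x)\<^sup>2) = of_real (sqrt (1 + x\<^sup>2))"
    using csqrt_of_real[of "1 + x\<^sup>2"] by simp
  then show ?thesis
    by (simp add: ray_kernel_def real_kernel_def flip: sinc_fun_of_real)
qed

lemma ray_kernel_imaginary: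
  assumes "\<bar>m\<bar> < 1"
  shows "ray_kernel \<sigma> (\<i> * of_real m) = of_real (imag_kernel \<sigma> m)"
proof -
  have "m\<^sup>2 < 1" using assms by (simp add: abs_square_less_1)
  then have root: "csqrt (1 + (\<i> * of_real m)\<^sup>2) = of_real (sqrt (1 - m\<^sup>2))"
    using csqrt_of_real[of "1 - m\<^sup>2"] by (simp add: power_mult_distrib)
  define y where "y = \<sigma> * m * sqrt (1 - m\<^sup>2)"
  have "sinc_fun (of_real \<sigma> * (\<i> * of_real m) * of_real (sqrt (1 - m\<^sup>2))) = sinc_fun (\<i> * complex_of_real y)"
    by (simp add: y_def mult_ac)
  also have "\<dots> = of_real (if y = 0 then 1 else sinh y / y)"
  proof -
    have "sin (\<i> * complex_of_real y) = \<i> * of_real (sinh y)"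
      by (simp add: sin_conv_sinh sinh_of_real flip: mult.assoc)
    then show ?thesis by (simp add: sinc_fun_def)
  qed
  finally show ?thesis
    by (simp add: ray_kernel_def imag_kernel_def root y_def Let_def)
qed

definition real_kernel_integral :: "real \<Rightarrow> real \<Rightarrow> real" where
  "real_kernel_integral \<sigma> u = integral {0..pi/2} (\<lambda>\<phi>. real_kernel \<sigma> (sinh (u / 2) * sin \<phi>))"

definition imag_kernel_integral :: "real \<Rightarrow> real \<Rightarrow> real" where
  "imag_kernel_integral \<sigma> \<theta> = integral {0..pi/2} (\<lambda>\<phi>. imag_kernel \<sigma> (sin (\<theta> / 2) * sin \<phi>))"

text \<open>Inherited from the holomorphic kernel, so the removable singularity is not treated
  again.\<close>

lemma continuous_on_real_kernel: "continuous_on A (real_kernel \<sigma>)"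
proof -
  have "continuous_on UNIV (\<lambda>x. Re (ray_kernel \<sigma> (of_real x)))"
  proof (intro continuous_intros continuous_on_compose2[OF holomorphic_on_imp_continuous_on[OF holomorphic_on_ray_kernel]])
    show "complex_of_real ` UNIV \<subseteq> kernel_dom"
    proof clarify
      fix x :: real
      have "1 + x\<^sup>2 > 0" by (smt (verit) zero_le_power2)
      then show "complex_of_real x \<in> kernel_dom"
        using nonpos_Reals_of_real_iff[of "1 + x\<^sup>2"] by (simp add: kernel_dom_def)
    qed
  qed
  then show ?thesis
    using continuous_on_subset by (auto simp: ray_kernel_of_real)
qed

lemma sabr_kernel_integral_of_real:
  "sabr_kernel_integral \<sigma> (of_real u) = of_real (real_kernel_integral \<sigma> u)"
proof -
  have "ray_kernel \<sigma> (sinh (complex_of_real u / 2) * of_real (sin \<phi>)) = of_real (real_kernel \<sigma> (sinh (u / 2) * sin \<phi>))" for \<phi>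
    using ray_kernel_of_real[of \<sigma> "sinh (u / 2) * sin \<phi>"] sinh_of_real[of "u / 2"] by simp
  moreover have int: "(\<lambda>\<phi>. real_kernel \<sigma> (sinh (u / 2) * sin \<phi>)) integrable_on {0..pi/2}"
    by (intro integrable_continuous_real continuous_on_compose2[OF continuous_on_real_kernel[of UNIV]] continuous_intros) auto
  ultimately show ?thesis
    using has_integral_of_real[OF integrable_integral[OF int], where 'b = complex]
    by (simp add: sabr_kernel_integral_def real_kernel_integral_def integral_unique)
qed

lemma imag_kernel_integrable:
  assumes "\<bar>\<theta>\<bar> < pi"
  shows "(\<lambda>\<phi>. imag_kernel \<sigma> (sin (\<theta> / 2) * sin \<phi>)) integrable_on {0..pi/2}"
    and "sabr_kernel_integral \<sigma> (\<i> * of_real \<theta>) = of_real (imag_kernel_integral \<sigma> \<theta>)"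
proof -
  have "cos (\<theta> / 2) > 0" by (rule cos_gt_zero_pi) (use assms in linarith)+
  then have "(sin (\<theta> / 2))\<^sup>2 < 1" by (intro sin_squared_less_1) simp
  then have sin: "\<bar>sin (\<theta> / 2)\<bar> < 1" by (simp only: abs_square_less_1)
  have m: "\<bar>sin (\<theta> / 2) * sin \<phi>\<bar> < 1" for \<phi>
    using le_less_trans[OF mult_left_le[OF abs_sin_le_one[of \<phi>] abs_ge_zero] sin]
    by (simp only: abs_mult)
  have arg: "sinh (\<i> * complex_of_real \<theta> / 2) * of_real (sin \<phi>) = \<i> * of_real (sin (\<theta> / 2) * sin \<phi>)" for \<phi>
    using sin_of_real[of "\<theta> / 2", where 'a = complex] by (simp add: sinh_conv_sin flip: mult.assoc)
  have eq: "ray_kernel \<sigma> (sinh (\<i> * complex_of_real \<theta> / 2) * of_real (sin \<phi>))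
      = of_real (imag_kernel \<sigma> (sin (\<theta> / 2) * sin \<phi>))" for \<phi>
    unfolding arg by (rule ray_kernel_imaginary[OF m])
  have strip: "\<i> * complex_of_real \<theta> \<in> strip" using assms by (simp add: strip_def)
  have "continuous_on {0..pi/2} (\<lambda>\<phi>. ray_kernel \<sigma> (sinh (\<i> * complex_of_real \<theta> / 2) * of_real (sin \<phi>)))"
    by (rule continuous_on_compose2[OF holomorphic_on_imp_continuous_on[OF holomorphic_on_ray_kernel]])
      (use sinh_half_in_kernel_dom[OF strip] sin_in_unit in \<open>auto intro!: continuous_intros\<close>)
  then have "continuous_on {0..pi/2} (\<lambda>\<phi>. Re (ray_kernel \<sigma> (sinh (\<i> * complex_of_real \<theta> / 2) * of_real (sin \<phi>))))"
    by (intro continuous_intros)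
  then show int: "(\<lambda>\<phi>. imag_kernel \<sigma> (sin (\<theta> / 2) * sin \<phi>)) integrable_on {0..pi/2}"
    unfolding eq by (intro integrable_continuous_real) simp
  show "sabr_kernel_integral \<sigma> (\<i> * of_real \<theta>) = of_real (imag_kernel_integral \<sigma> \<theta>)"
    using has_integral_of_real[OF integrable_integral[OF int], where 'b = complex]
    by (simp add: sabr_kernel_integral_def imag_kernel_integral_def integral_unique eq)
qed

definition sabr_g_ray :: "real \<Rightarrow> real \<Rightarrow> real" where
  "sabr_g_ray \<sigma> u = \<sigma> / sqrt 2 * sinh u * real_kernel_integral \<sigma> u"

lemma sabr_g_complex_of_real: "sabr_g_complex \<sigma> (of_real u) = of_real (sabr_g_ray \<sigma> u)"
  by (simp add: sabr_g_complex_def sabr_g_ray_def sabr_kernel_integral_of_real sinh_of_real)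

lemma sabr_g_complex_imaginary:
  assumes "\<bar>\<theta>\<bar> < pi"
  shows "sabr_g_complex \<sigma> (\<i> * of_real \<theta>) = \<i> * of_real (\<sigma> / sqrt 2 * sin \<theta> * imag_kernel_integral \<sigma> \<theta>)"
  by (simp add: sabr_g_complex_def imag_kernel_integrable(2)[OF assms] sinh_conv_sin sin_of_real flip: mult.assoc)

lemma abs_real_kernel_le_1: "\<bar>real_kernel \<sigma> x\<bar> \<le> 1"
proof -
  have root: "sqrt (1 + x\<^sup>2) \<ge> 1" by simp
  have "\<bar>sinc_fun (\<sigma> * x * sqrt (1 + x\<^sup>2))\<bar> \<le> sqrt (1 + x\<^sup>2)"
    using order_trans[OF abs_sinc_fun_le_1 root] .
  then have "\<bar>sinc_fun (\<sigma> * x * sqrt (1 + x\<^sup>2))\<bar> / sqrt (1 + x\<^sup>2) \<le> 1"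
    using root by (subst divide_le_eq_1_pos) linarith+
  then show ?thesis by (simp add: real_kernel_def abs_divide)
qed

lemma abs_sabr_g_ray_le:
  assumes "\<sigma> > 0" "u \<ge> 0"
  shows "\<bar>sabr_g_ray \<sigma> u\<bar> \<le> \<sigma> * pi * exp u"
proof -
  have "norm (real_kernel_integral \<sigma> u) \<le> 1 * (pi / 2 - 0)"
    unfolding real_kernel_integral_def
    by (rule integral_bound)
      (auto simp: abs_real_kernel_le_1 intro!: continuous_on_compose2[OF continuous_on_real_kernel[of UNIV]]
         continuous_intros)
  then have I: "\<bar>real_kernel_integral \<sigma> u\<bar> \<le> pi / 2" by simp
  have s0: "0 \<le> sinh u" using assms by simp
  have "- exp (- u) \<le> exp u" by (rule order_trans[of _ 0]) simp_all
  then have s: "sinh u \<le> exp u" by (simp add: sinh_field_def)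
  have "\<sigma> / sqrt 2 \<le> \<sigma>" using assms by (simp add: divide_le_eq)
  then have "\<sigma> / sqrt 2 * sinh u * \<bar>real_kernel_integral \<sigma> u\<bar> \<le> \<sigma> * exp u * (pi / 2)"
    using s s0 I assms by (intro mult_mono) auto
  also have "\<dots> \<le> \<sigma> * pi * exp u" using assms by simp
  finally show ?thesis using s0 assms by (simp add: sabr_g_ray_def abs_mult)
qed

lemma continuous_on_sabr_g_ray: "continuous_on A (sabr_g_ray \<sigma>)"
proof -
  have "continuous_on UNIV (\<lambda>u. Re (sabr_g_complex \<sigma> (of_real u)))"
    by (intro continuous_intros continuous_on_compose2[OF
        holomorphic_on_imp_continuous_on[OF holomorphic_on_sabr_g_complex]]) auto
  then show ?thesis
    using continuous_on_subset by (auto simp: sabr_g_complex_of_real)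
qed

text \<open>The Taylor coefficients are in fact real; taking the real part avoids having to prove it.\<close>
definition sabr_coeff :: "real \<Rightarrow> nat \<Rightarrow> real" where
  "sabr_coeff \<sigma> k = Re ((deriv ^^ (2 * k + 1)) (sabr_g_complex \<sigma>) 0 / fact (2 * k + 1))"

text \<open>The kernel is even in \<open>n\<close> because \<open>sinc_fun\<close> is, so the kernel
  integral is even in \<open>z\<close>, and the factor \<open>sinh z\<close> is odd.\<close>

lemma sabr_g_complex_minus: "sabr_g_complex \<sigma> (- z) = - sabr_g_complex \<sigma> z"
proof -
  have "ray_kernel \<sigma> (- n) = ray_kernel \<sigma> n" for n
    by (simp add: ray_kernel_def sinc_fun_def)
  then show ?thesis
    by (simp add: sabr_g_complex_def sabr_kernel_integral_def)
qed

lemma sabr_g_complex_sums: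
  assumes "norm z < pi"
  shows "(\<lambda>k. (deriv ^^ (2 * k + 1)) (sabr_g_complex \<sigma>) 0 / fact (2 * k + 1) * z ^ (2 * k + 1))
    sums sabr_g_complex \<sigma> z"
proof -
  define c where "c n = (deriv ^^ n) (sabr_g_complex \<sigma>) 0 / fact n" for n
  have "ball 0 pi \<subseteq> strip"
    using le_less_trans[OF abs_Im_le_cmod] by (auto simp: strip_def)
  then have hol: "sabr_g_complex \<sigma> holomorphic_on ball 0 pi"
    using holomorphic_on_sabr_g_complex holomorphic_on_subset by blast
  have S: "(\<lambda>n. c n * w ^ n) sums sabr_g_complex \<sigma> w" if "norm w < pi" for w
    using holomorphic_power_series[OF hol, of w] that by (simp add: c_def)
  \<comment> \<open>Half the difference of the series at \<open>z\<close> and at \<open>- z\<close>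
    removes the even powers and, by oddness, keeps the sum.\<close>
  have "(\<lambda>n. (c n * z ^ n - c n * (- z) ^ n) / 2) sums ((sabr_g_complex \<sigma> z - sabr_g_complex \<sigma> (- z)) / 2)"
    using assms by (intro sums_divide sums_diff S) auto
  then have *: "(\<lambda>n. (c n * z ^ n - c n * (- z) ^ n) / 2) sums sabr_g_complex \<sigma> z"
    by (simp add: sabr_g_complex_minus)
  have "(\<lambda>k. (c (2 * k + 1) * z ^ (2 * k + 1) - c (2 * k + 1) * (- z) ^ (2 * k + 1)) / 2) sums sabr_g_complex \<sigma> z"
  proof (subst sums_mono_reindex[where g = "\<lambda>k. 2 * k + 1" and f = "\<lambda>n. (c n * z ^ n - c n * (- z) ^ n) / 2"])
    show "strict_mono (\<lambda>k::nat. 2 * k + 1)" by (auto intro: strict_monoI)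
    show "(c n * z ^ n - c n * (- z) ^ n) / 2 = 0" if "n \<notin> range (\<lambda>k. 2 * k + 1)" for n
    proof -
      have "even n" using that by (metis oddE rangeI)
      then show ?thesis by simp
    qed
  qed (rule *)
  moreover have "(a * w ^ (2 * k + 1) - a * (- w) ^ (2 * k + 1)) / 2 = a * w ^ (2 * k + 1)" for a w :: complex and k
    by simp
  ultimately show ?thesis by (simp only: c_def)
qed

lemma sabr_g_ray_sums:
  assumes "\<bar>u\<bar> < pi"
  shows "(\<lambda>k. sabr_coeff \<sigma> k * u ^ (2 * k + 1)) sums sabr_g_ray \<sigma> u"
proof -
  have "(\<lambda>k. Re ((deriv ^^ (2 * k + 1)) (sabr_g_complex \<sigma>) 0 / fact (2 * k + 1) * of_real u ^ (2 * k + 1)))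
      sums Re (sabr_g_complex \<sigma> (of_real u))"
    using assms by (intro sums_Re sabr_g_complex_sums) simp
  then show ?thesis
    by (simp only: sabr_g_complex_of_real Re_complex_of_real sabr_coeff_def times_complex.simps
          flip: of_real_power) simp
qed

text \<open>Odd powers of \<open>\<i> * \<theta>\<close> are \<open>\<i>\<close> times a real
  number, so the imaginary part of the series sees the real parts of the Taylor coefficients, with
  alternating signs.\<close>

lemma imag_kernel_integral_sums:
  assumes "\<bar>\<theta>\<bar> < pi"
  shows "(\<lambda>k. sabr_coeff \<sigma> k * (-1) ^ k * \<theta> ^ (2 * k + 1)) sums (\<sigma> / sqrt 2 * sin \<theta> * imag_kernel_integral \<sigma> \<theta>)"
proof -
  have "(\<lambda>k. Im ((deriv ^^ (2 * k + 1)) (sabr_g_complex \<sigma>) 0 / fact (2 * k + 1) * (\<i> * of_real \<theta>) ^ (2 * k + 1)))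
      sums Im (sabr_g_complex \<sigma> (\<i> * of_real \<theta>))"
    using assms by (intro sums_Im sabr_g_complex_sums) (simp add: norm_mult)
  also have "Im (sabr_g_complex \<sigma> (\<i> * of_real \<theta>)) = \<sigma> / sqrt 2 * sin \<theta> * imag_kernel_integral \<sigma> \<theta>"
    by (simp only: sabr_g_complex_imaginary[OF assms]) simp
  also have "(\<lambda>k. Im ((deriv ^^ (2 * k + 1)) (sabr_g_complex \<sigma>) 0 / fact (2 * k + 1) * (\<i> * of_real \<theta>) ^ (2 * k + 1)))
     = (\<lambda>k. sabr_coeff \<sigma> k * (-1) ^ k * \<theta> ^ (2 * k + 1))"
  proof
    fix k
    have "(\<i> * complex_of_real \<theta>) ^ (2 * k + 1) = \<i> * of_real ((-1) ^ k * \<theta> ^ (2 * k + 1))"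
      by (simp add: power_mult_distrib power_mult flip: power_mult_distrib[of "-1"])
    moreover have "Im (c * (\<i> * of_real t)) = Re c * t" for c t by simp
    ultimately show "Im ((deriv ^^ (2 * k + 1)) (sabr_g_complex \<sigma>) 0 / fact (2 * k + 1) * (\<i> * of_real \<theta>) ^ (2 * k + 1))
       = sabr_coeff \<sigma> k * (-1) ^ k * \<theta> ^ (2 * k + 1)"
      by (simp only: sabr_coeff_def mult.assoc)
  qed
  finally show ?thesis .
qed

section \<open>The integrand of the price formula\<close>

lemma sabr_h_eq_sinc: "sabr_h \<sigma> s = \<sigma> / 2 * sinc_fun (\<sigma> / 2 * sinh s)"
  by (auto simp: sabr_h_def sinc_fun_def)

lemma borel_measurable_sabr_h [measurable]: "sabr_h \<sigma> \<in> borel_measurable borel"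
proof -
  have [measurable]: "(sinh :: real \<Rightarrow> real) \<in> borel_measurable borel"
    by (intro borel_measurable_continuous_onI continuous_intros)
  show ?thesis unfolding sabr_h_def[abs_def] by measurable
qed

text \<open>The substitution \<open>sinh (s / 2) = sinh (u / 2) * sin \<phi>\<close> removes the square-root singularity
  at \<open>s = u\<close>.\<close>
lemma sabr_g_eq_ray:
  assumes u: "u > 0"
  shows "sabr_g \<sigma> u = sabr_g_ray \<sigma> u"
proof -
  define w where "w = sinh (u / 2)"
  have w: "w > 0" using u by (simp add: w_def)
  define s where "s \<phi> = 2 * arsinh (w * sin \<phi>)" for \<phi> :: real
  define s' where "s' \<phi> = 2 * (w * cos \<phi>) / sqrt (1 + (w * sin \<phi>)\<^sup>2)" for \<phi> :: real
  define f where "f x = sabr_h \<sigma> x / sqrt (cosh u - cosh x)" for x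
  define k where "k \<phi> = \<sigma> / sqrt 2 * real_kernel \<sigma> (w * sin \<phi>)" for \<phi>
  let ?S = "{0<..<pi/2} :: real set"
  have trig: "sin \<phi> > 0" "cos \<phi> > 0" if "\<phi> \<in> ?S" for \<phi>
    using that by (auto intro!: sin_gt_zero cos_gt_zero)
  have half: "sinh (s \<phi> / 2) = w * sin \<phi>" for \<phi> by (simp add: s_def)
  have coshx: "cosh x = 1 + 2 * (sinh (x / 2))\<^sup>2" for x :: real
    using cosh_double[of "x / 2"] cosh_square_eq[of "x / 2"] by simp
  have sinhx: "sinh x = 2 * sinh (x / 2) * sqrt (1 + (sinh (x / 2))\<^sup>2)" for x :: real
  proof -
    have "sqrt (1 + (sinh (x / 2))\<^sup>2) = cosh (x / 2)"
      by (rule real_sqrt_unique) (auto simp: cosh_square_eq)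
    then show ?thesis using sinh_double[of "x / 2"] by simp
  qed
  have der: "(s has_field_derivative s' \<phi>) (at \<phi> within A)" for \<phi> A
    unfolding s_def[abs_def] s'_def
    by (rule has_field_derivative_at_within, rule DERIV_cong[OF DERIV_cmult[OF
          DERIV_chain2[where f = arsinh and g = "\<lambda>\<phi>. w * sin \<phi>",
            OF arsinh_real_has_field_derivative[of _ UNIV] DERIV_cmult[OF DERIV_sin]]]])
      (simp add: add.commute)
  have inj: "inj_on s ?S"
  proof (rule inj_onI)
    fix x y assume *: "x \<in> ?S" "y \<in> ?S" "s x = s y"
    then have "w * sin x = w * sin y" using half[of x] half[of y] by metis
    then have "sin x = sin y" using w by simp
    moreover have "0 < x" "x < pi/2" "0 < y" "y < pi/2" using *(1,2) by simp_all
    ultimately show "x = y" using pi_gt_zero by (intro sin_inj_pi[of x y]) linarith+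
  qed
  have im: "s ` ?S = {0<..<u}"
  proof safe
    fix \<phi> assume \<phi>: "\<phi> \<in> ?S"
    have "w * sin \<phi> > 0" using w trig[OF \<phi>] by simp
    then show "s \<phi> \<in> {0<..<u}"
    proof -
      have "(sin \<phi>)\<^sup>2 < 1" using trig[OF \<phi>] by (intro sin_squared_less_1) simp
      then have "sin \<phi> < 1" using trig[OF \<phi>] by (simp add: abs_square_less_1)
      then have "sinh (s \<phi> / 2) < sinh (u / 2)" using w by (simp add: half flip: w_def)
      moreover have "sinh 0 < sinh (s \<phi> / 2)" using \<open>w * sin \<phi> > 0\<close> by (simp add: half)
      ultimately show ?thesis by (simp only: sinh_real_less_iff) simp
    qed
  next
    fix x assume x: "x \<in> {0<..<u}"
    define q where "q = sinh (x / 2) / w"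
    have q: "0 < q" "q < 1" using x w by (auto simp: q_def w_def divide_less_eq)
    have "s (arcsin q) = x" using q w by (simp add: s_def q_def arsinh_sinh_real)
    moreover have "arcsin q \<in> ?S"
      using q arcsin_less_arcsin[of 0 q] arcsin_less_arcsin[of q 1] by simp
    ultimately show "x \<in> s ` ?S" by (metis imageI)
  qed
  \<comment> \<open>The factor \<open>cos \<phi>\<close> of the derivative cancels the square root
    that vanishes at \<open>s = u\<close>, leaving a function continuous up to the
    endpoints.\<close>
  have eq: "\<bar>s' \<phi>\<bar> * f (s \<phi>) = k \<phi>" if "\<phi> \<in> ?S" for \<phi>
  proof -
    note t = trig[OF that]
    define q where "q = sqrt (1 + (w * sin \<phi>)\<^sup>2)"
    have q: "q > 0" by (auto simp: q_def intro: add_pos_nonneg)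
    have "cosh u - cosh (s \<phi>) = 2 * w\<^sup>2 * (1 - (sin \<phi>)\<^sup>2)"
      by (subst (1 2) coshx) (simp add: half w_def power_mult_distrib algebra_simps)
    also have "\<dots> = 2 * (w * cos \<phi>)\<^sup>2" by (simp add: cos_squared_eq power_mult_distrib)
    finally have e1: "sqrt (cosh u - cosh (s \<phi>)) = sqrt 2 * (w * cos \<phi>)"
      using t w by (simp add: real_sqrt_mult)
    define A where "A = sinc_fun (\<sigma> * (w * sin \<phi>) * q)"
    have e2: "sabr_h \<sigma> (s \<phi>) = \<sigma> / 2 * A"
      unfolding sabr_h_eq_sinc A_def q_def by (subst sinhx) (simp add: half mult_ac)
    have "\<bar>s' \<phi>\<bar> = 2 * (w * cos \<phi>) / q"
      using t w q by (simp add: s'_def q_def)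
    then have "\<bar>s' \<phi>\<bar> * f (s \<phi>) = 2 * (w * cos \<phi>) / q * (\<sigma> / 2 * A / (sqrt 2 * (w * cos \<phi>)))"
      by (simp only: f_def e1 e2)
    also have "\<dots> = \<sigma> / sqrt 2 * (A / q)"
      using t w q by (simp add: field_simps)
    finally show ?thesis
      by (simp only: k_def real_kernel_def A_def q_def)
  qed
  have cont: "continuous_on {0..pi/2} k"
    unfolding k_def
    by (intro continuous_intros continuous_on_compose2[OF continuous_on_real_kernel[of UNIV]]) auto
  have "k absolutely_integrable_on {0..pi/2}"
    using cont by (rule absolutely_integrable_continuous_real)
  then have absk: "k absolutely_integrable_on ?S"
    by (rule set_integrable_subset) auto
  have intk: "integral ?S k = \<sigma> / sqrt 2 * real_kernel_integral \<sigma> u"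
    by (simp add: integral_open_interval_real k_def[abs_def] real_kernel_integral_def w_def)
  have "(\<lambda>\<phi>. \<bar>s' \<phi>\<bar> * f (s \<phi>)) absolutely_integrable_on ?S"
    by (subst set_integrable_cong[OF refl refl eq]) (use absk in auto)
  moreover have "integral ?S (\<lambda>\<phi>. \<bar>s' \<phi>\<bar> * f (s \<phi>)) = \<sigma> / sqrt 2 * real_kernel_integral \<sigma> u"
    unfolding intk[symmetric] by (rule integral_cong[OF eq])
  ultimately have f: "f absolutely_integrable_on {0<..<u}"
    "integral {0<..<u} f = \<sigma> / sqrt 2 * real_kernel_integral \<sigma> u"
    using has_absolute_integral_change_of_variables_1'[OF _ der inj, where b = "\<sigma> / sqrt 2 * real_kernel_integral \<sigma> u" and f = f]
    unfolding im by auto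
  \<comment> \<open>The change of variables lives in Lebesgue measure, the completion of
    \<open>lborel\<close>; Borel measurability brings the integral back to
    \<open>lborel\<close>.\<close>
  have "(\<lambda>x. indicat_real {0<..<u} x *\<^sub>R f x) \<in> borel_measurable lborel"
  proof -
    have [measurable]: "(cosh :: real \<Rightarrow> real) \<in> borel_measurable borel"
      by (intro borel_measurable_continuous_onI continuous_intros)
    show ?thesis unfolding f_def by measurable
  qed
  then have "set_integrable lborel {0<..<u} f"
    using f(1) integrable_completion unfolding set_integrable_def by blast
  then have "(LBINT x:{0<..<u}. f x) = \<sigma> / sqrt 2 * real_kernel_integral \<sigma> u"
    using set_borel_integral_eq_integral(2) f(2) by metis
  then show ?thesis
    by (simp add: sabr_g_def sabr_g_ray_def f_def)
qed

subsection \<open>The singularity on the imaginary axis\<close>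

text \<open>The mean value theorem gives \<open>sin (x / 2) >= x / 2 * cos (x / 2)\<close>. Doubling
  the angle, \<open>sin x >= x * (cos (x / 2)) ^ 2 = x * (1 + cos x) / 2\<close>, and
  \<open>cos x >= 0\<close>.\<close>

lemma half_le_sin:
  assumes "0 \<le> x" "x \<le> pi / 2"
  shows "x / 2 \<le> sin x"
proof (cases "x = 0")
  case False
  then have x: "0 < x" using assms by simp
  obtain z where z: "0 < z" "z < x / 2" "sin (x / 2) - sin 0 = (x / 2 - 0) * cos z"
    using MVT2[of 0 "x / 2" sin cos] x by (auto intro: DERIV_sin)
  have "cos (x / 2) \<le> cos z"
    using z assms pi_gt_zero by (intro cos_monotone_0_pi_le) linarith+
  then have s: "x / 2 * cos (x / 2) \<le> sin (x / 2)"
    using z(3) x by (simp add: mult_left_mono)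
  have c: "0 \<le> cos (x / 2)" "0 \<le> cos x"
    using assms pi_gt_zero by (auto intro!: cos_ge_zero)
  have "x * (cos (x / 2))\<^sup>2 = 2 * (x / 2 * cos (x / 2)) * cos (x / 2)"
    by (simp add: power2_eq_square)
  also have "\<dots> \<le> 2 * sin (x / 2) * cos (x / 2)"
    using s c by (intro mult_right_mono) auto
  also have "\<dots> = sin x" using sin_double[of "x / 2"] by simp
  finally have "x * (cos (x / 2))\<^sup>2 \<le> sin x" .
  moreover have "(cos (x / 2))\<^sup>2 = (1 + cos x) / 2"
    using cos_double_cos[of "x / 2"] by simp
  moreover have "x * (1 / 2) \<le> x * ((1 + cos x) / 2)" using x c by (intro mult_left_mono) auto
  ultimately show ?thesis by simp
qed simp

text \<open>For \<open>y > 0\<close> the quotient equals \<open>cosh z\<close> for some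
  \<open>z\<close> between 0 and \<open>y\<close>, by the mean value theorem.\<close>

lemma sinhc_bounds:
  assumes "0 \<le> (y::real)"
  shows "1 \<le> (if y = 0 then 1 else sinh y / y)" "(if y = 0 then 1 else sinh y / y) \<le> cosh y"
proof -
  have "1 \<le> sinh y / y \<and> sinh y / y \<le> cosh y" if "y \<noteq> 0"
  proof -
    have y: "0 < y" using that assms by simp
    have d: "(sinh has_real_derivative cosh x) (at x)" for x :: real
      by (auto intro!: derivative_eq_intros)
    obtain z where z: "0 < z" "z < y" "sinh y - sinh 0 = (y - 0) * cosh z"
      using MVT2[OF y d] by blast
    then have "sinh y / y = cosh z" using y by simp
    moreover have "cosh z \<le> cosh y" using z by (subst cosh_real_nonneg_le_iff) auto
    ultimately show ?thesis using cosh_real_ge_1[of z] by simp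
  qed
  then show "1 \<le> (if y = 0 then 1 else sinh y / y)" "(if y = 0 then 1 else sinh y / y) \<le> cosh y"
    by auto
qed

text \<open>With \<open>p = pi / 2 - \<phi>\<close>, the quantity
  \<open>1 - m ^ 2 = (sin p) ^ 2 + c ^ 2 * (sin \<phi>) ^ 2\<close> is comparable to
  \<open>(p + c) ^ 2\<close>, and the \<open>sinh\<close> quotient lies between 1 and
  \<open>cosh \<sigma>\<close>. This pins the kernel to a function with an elementary
  integral.\<close>

lemma imag_kernel_bounds:
  assumes \<sigma>: "\<sigma> > 0" and \<theta>: "0 < \<theta>" "\<theta> < pi" and \<phi>: "\<phi> \<in> {0..pi/2}"
  defines "c \<equiv> cos (\<theta> / 2)" and "m \<equiv> sin (\<theta> / 2) * sin \<phi>"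
  shows "1 / (pi / 2 - \<phi> + c) \<le> imag_kernel \<sigma> m"
    and "imag_kernel \<sigma> m \<le> cosh \<sigma> * 4 * (1 / (pi / 2 - \<phi> + c))"
proof -
  define p where "p = pi / 2 - \<phi>"
  have p: "0 \<le> p" "p \<le> pi / 2" using \<phi> by (auto simp: p_def)
  have c: "0 < c" "c \<le> 1" unfolding c_def using \<theta> by (auto intro!: cos_gt_zero)
  have "0 \<le> sin \<phi>" "sin \<phi> \<le> 1" using sin_in_unit[OF \<phi>] by auto
  moreover have "0 \<le> sin (\<theta> / 2)" "sin (\<theta> / 2) \<le> 1" using \<theta> by (auto intro!: sin_ge_zero)
  ultimately have m: "0 \<le> m" "m \<le> 1" by (auto simp: m_def mult_le_one)
  define K where "K = 1 - m\<^sup>2"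
  have "cos \<phi> = sin p" by (simp add: p_def sin_diff)
  have K1: "K = (sin p)\<^sup>2 + c\<^sup>2 * (sin \<phi>)\<^sup>2"
    unfolding K_def m_def c_def power_mult_distrib cos_squared_eq[of "\<theta> / 2"]
      \<open>cos \<phi> = sin p\<close>[symmetric] cos_squared_eq[of \<phi>]
    by (simp add: algebra_simps)
  \<comment> \<open>This second form shows \<open>c ^ 2 <= K\<close>, since
    \<open>c <= 1\<close>.\<close>
  have K2: "K = c\<^sup>2 + (1 - c\<^sup>2) * (sin p)\<^sup>2"
    unfolding K1 sin_squared_eq[of \<phi>] \<open>cos \<phi> = sin p\<close> by (simp add: algebra_simps)
  have c2: "c\<^sup>2 \<le> 1" using c by (simp add: power_le_one)
  have sp: "p / 2 \<le> sin p" "sin p \<le> p" "0 \<le> sin p"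
    using half_le_sin[OF p] sin_x_le_x p by auto
  have "(sin p)\<^sup>2 \<le> p\<^sup>2" using sp by (intro power_mono) auto
  moreover have "c\<^sup>2 * (sin \<phi>)\<^sup>2 \<le> c\<^sup>2" by (intro mult_left_le) (auto simp: abs_square_le_1)
  ultimately have "K \<le> p\<^sup>2 + c\<^sup>2" using K1 by linarith
  also have "\<dots> \<le> (p + c)\<^sup>2" using p c by (simp add: power2_sum)
  finally have "sqrt K \<le> sqrt ((p + c)\<^sup>2)" by (rule real_sqrt_le_mono)
  then have up: "sqrt K \<le> p + c" using p c by simp
  have "(p + c)\<^sup>2 \<le> 2 * (p\<^sup>2 + c\<^sup>2)" using sum_squares_bound[of p c] by (simp add: power2_sum)
  moreover have "(p / 2)\<^sup>2 \<le> (sin p)\<^sup>2" using sp p by (intro power_mono) auto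
  then have "(p / 2)\<^sup>2 \<le> K" using K1 by (smt (verit) zero_le_mult_iff zero_le_power2)
  moreover have "c\<^sup>2 \<le> K" using K2 c2 by simp
  moreover from this have "0 \<le> K" by (rule order_trans[rotated]) simp
  \<comment> \<open>Here \<open>p ^ 2 <= 4 * K\<close> and \<open>c ^ 2 <= K\<close>, so
    \<open>(p + c) ^ 2 <= 10 * K\<close>; the divisor 16 leaves room.\<close>
  ultimately have "((p + c) / 4)\<^sup>2 \<le> K" by (simp add: power_divide)
  then have "sqrt (((p + c) / 4)\<^sup>2) \<le> sqrt K" by (rule real_sqrt_le_mono)
  then have low: "(p + c) / 4 \<le> sqrt K" using p c by simp
  have "0 < (p + c) / 4" using p c by simp
  then have K0: "0 < sqrt K" using low by (rule less_le_trans)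
  define y where "y = \<sigma> * m * sqrt K"
  have "sqrt K \<le> 1" by (simp add: K_def)
  then have "m * sqrt K \<le> 1" using m K0 by (intro mult_le_one) auto
  then have y: "0 \<le> y" "y \<le> \<sigma>" using \<sigma> m K0 by (auto simp: y_def mult.assoc intro!: mult_left_le)
  define Y where "Y = (if y = 0 then 1 else sinh y / y)"
  have Y: "1 \<le> Y" "Y \<le> cosh \<sigma>"
    using sinhc_bounds[OF y(1)] cosh_real_nonneg_le_iff[of y \<sigma>] y \<sigma>
    unfolding Y_def by (auto intro: order_trans[of _ "cosh y"] cosh_real_ge_1)
  have eq: "imag_kernel \<sigma> m = Y / sqrt K"
    by (simp only: imag_kernel_def Let_def Y_def y_def K_def)
  show "1 / (pi / 2 - \<phi> + c) \<le> imag_kernel \<sigma> m"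
    unfolding eq p_def[symmetric] using up K0 Y by (intro frac_le) auto
  have "Y / sqrt K \<le> cosh \<sigma> / ((p + c) / 4)"
    using low p c Y by (intro frac_le) auto
  then show "imag_kernel \<sigma> m \<le> cosh \<sigma> * 4 * (1 / (pi / 2 - \<phi> + c))"
    unfolding eq p_def[symmetric] by simp
qed

lemma has_integral_log_kernel:
  assumes "c > 0"
  shows "((\<lambda>\<phi>. 1 / (pi / 2 - \<phi> + c)) has_integral (ln (pi / 2 + c) - ln c)) {0..pi/2}"
proof -
  have "((\<lambda>\<phi>. 1 / (pi / 2 - \<phi> + c)) has_integral (- ln (pi / 2 - pi / 2 + c) - - ln (pi / 2 - 0 + c))) {0..pi/2}"
    using assms
    by (intro fundamental_theorem_of_calculus)
      (auto intro!: derivative_eq_intros simp: divide_simps simp flip: has_real_derivative_iff_has_vector_derivative)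
  then show ?thesis by simp
qed

text \<open>As \<open>\<theta>\<close> tends to \<open>pi\<close>, \<open>c\<close> tends to 0 and
  both bounds grow like a multiple of \<open>- ln c\<close>. The upper one will give the boundary
  value 0, the lower one the infinite slope.\<close>

lemma imag_kernel_integral_bounds:
  assumes "\<sigma> > 0" "0 < \<theta>" "\<theta> < pi"
  defines "c \<equiv> cos (\<theta> / 2)"
  shows "ln (pi / 2 + c) - ln c \<le> imag_kernel_integral \<sigma> \<theta>"
    and "imag_kernel_integral \<sigma> \<theta> \<le> cosh \<sigma> * 4 * (ln (pi / 2 + c) - ln c)"
proof -
  have c: "0 < c" unfolding c_def using assms by (intro cos_gt_zero) auto
  have "((\<lambda>\<phi>. imag_kernel \<sigma> (sin (\<theta> / 2) * sin \<phi>)) has_integral imag_kernel_integral \<sigma> \<theta>) {0..pi/2}"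
    unfolding imag_kernel_integral_def
    using assms by (intro integrable_integral imag_kernel_integrable) auto
  note I = this
  show "ln (pi / 2 + c) - ln c \<le> imag_kernel_integral \<sigma> \<theta>"
    using imag_kernel_bounds(1)[OF assms(1-3)]
    by (intro has_integral_le[OF has_integral_log_kernel[OF c] I]) (auto simp: c_def)
  show "imag_kernel_integral \<sigma> \<theta> \<le> cosh \<sigma> * 4 * (ln (pi / 2 + c) - ln c)"
    using imag_kernel_bounds(2)[OF assms(1-3)]
    by (intro has_integral_le[OF I has_integral_mult_right[OF has_integral_log_kernel[OF c]]]) (auto simp: c_def)
qed

text \<open>On the imaginary axis \<open>sabr_g_complex\<close> behaves at distance \<open>t\<close> from \<open>\<i> * pi\<close> like \<open>t * ln t\<close>,
  so it has no differentiable continuation there.\<close>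
lemma sabr_coeff_not_entire:
  assumes \<sigma>: "\<sigma> > 0"
  shows "conv_radius (sabr_coeff \<sigma>) \<noteq> \<infinity>"
proof
  assume inf: "conv_radius (sabr_coeff \<sigma>) = \<infinity>"
  define e where "e k = sabr_coeff \<sigma> k * (-1) ^ k" for k
  have "conv_radius e = \<infinity>"
    using inf conv_radius_norm[of e] conv_radius_norm[of "sabr_coeff \<sigma>"]
    by (simp only: e_def norm_mult norm_power norm_minus_cancel norm_one power_one mult_1_right)
  then have Y: "((\<lambda>w. \<Sum>k. e k * w ^ k) has_field_derivative (\<Sum>k. diffs e k * w ^ k)) (at w)" for w
    by (intro has_field_derivative_powser) simp
  \<comment> \<open>If the series were entire, \<open>S\<close> would continue the imaginary part of
    \<open>sabr_g_complex\<close> on the imaginary axis differentiably through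
    \<open>\<theta> = pi\<close>.\<close>
  define S where "S \<theta> = \<theta> * (\<Sum>k. e k * (\<theta>\<^sup>2) ^ k)" for \<theta>
  obtain D where D: "(S has_field_derivative D) (at pi)"
  proof -
    have "((\<lambda>\<theta>. \<Sum>k. e k * (\<theta>\<^sup>2) ^ k) has_field_derivative (\<Sum>k. diffs e k * (pi\<^sup>2) ^ k) * (2 * pi)) (at pi)"
      by (rule DERIV_chain2[OF Y]) (auto intro!: derivative_eq_intros)
    from DERIV_mult[OF DERIV_ident this] show thesis
      using that unfolding S_def[abs_def] by blast
  qed
  have S_eq: "S \<theta> = \<sigma> / sqrt 2 * sin \<theta> * imag_kernel_integral \<sigma> \<theta>" if "0 < \<theta>" "\<theta> < pi" for \<theta>
  proof -
    have "(\<lambda>k. \<theta> * (e k * (\<theta>\<^sup>2) ^ k)) sums (\<sigma> / sqrt 2 * sin \<theta> * imag_kernel_integral \<sigma> \<theta>)"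
      using imag_kernel_integral_sums[of \<theta> \<sigma>] that by (simp add: e_def mult_ac power_mult power2_eq_square power_mult_distrib)
    then have "(\<lambda>k. e k * (\<theta>\<^sup>2) ^ k) sums (\<sigma> / sqrt 2 * sin \<theta> * imag_kernel_integral \<sigma> \<theta> / \<theta>)"
      using that sums_mult_D by (metis less_irrefl)
    then show ?thesis using that by (simp add: S_def sums_iff)
  qed
  have ev: "eventually (\<lambda>\<theta>. 0 < \<theta> \<and> \<theta> < pi) (at_left pi)"
    using eventually_at_left_real[of 0 pi] by (auto elim: eventually_mono)
  have c: "filterlim (\<lambda>\<theta>. cos (\<theta> / 2)) (at_right 0) (at_left pi)"
    unfolding filterlim_at
  proof (rule conjI[rotated])
    show "((\<lambda>\<theta>. cos (\<theta> / 2)) \<longlongrightarrow> 0) (at_left pi)"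
      by (auto intro!: tendsto_eq_intros)
    show "\<forall>\<^sub>F \<theta> in at_left pi. cos (\<theta> / 2) \<in> {0<..} \<and> cos (\<theta> / 2) \<noteq> 0"
      using ev
    proof eventually_elim
      case (elim \<theta>)
      then have "0 < cos (\<theta> / 2)" by (intro cos_gt_zero) auto
      then show ?case by simp
    qed
  qed
  have lim: "((\<lambda>c. \<sigma> / sqrt 2 * (2 * c) * (cosh \<sigma> * 4 * (ln (pi / 2 + c) - ln c))) \<longlongrightarrow> 0) (at_right 0)"
    by real_asymp
  \<comment> \<open>With \<open>c = cos (\<theta> / 2)\<close>, the factor
    \<open>sin \<theta>\<close> is at most \<open>2 * c\<close>, and \<open>c * ln c\<close> tends
    to 0.\<close>
  have "(S \<longlongrightarrow> 0) (at_left pi)"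
  proof (rule Lim_null_comparison[OF _ filterlim_compose[OF lim c]])
    show "\<forall>\<^sub>F \<theta> in at_left pi. norm (S \<theta>) \<le> \<sigma> / sqrt 2 * (2 * cos (\<theta> / 2)) *
       (cosh \<sigma> * 4 * (ln (pi / 2 + cos (\<theta> / 2)) - ln (cos (\<theta> / 2))))"
      using ev
    proof eventually_elim
      case (elim \<theta>)
      have c: "0 < cos (\<theta> / 2)" using elim by (intro cos_gt_zero) auto
      have s: "0 < sin \<theta>" using elim by (intro sin_gt_zero) auto
      have "sin \<theta> = 2 * sin (\<theta> / 2) * cos (\<theta> / 2)" using sin_double[of "\<theta> / 2"] by simp
      then have s2: "sin \<theta> \<le> 2 * cos (\<theta> / 2)" using c by simp
      have "ln (cos (\<theta> / 2)) \<le> ln (pi / 2 + cos (\<theta> / 2))"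
        using c by (subst ln_le_cancel_iff) (auto intro: add_pos_pos)
      then have J: "0 \<le> imag_kernel_integral \<sigma> \<theta>"
        using imag_kernel_integral_bounds(1)[OF \<sigma>] elim by fastforce
      have "norm (S \<theta>) = \<sigma> / sqrt 2 * sin \<theta> * imag_kernel_integral \<sigma> \<theta>"
        using S_eq elim \<sigma> s J by (simp add: abs_mult)
      also have "\<dots> \<le> \<sigma> / sqrt 2 * (2 * cos (\<theta> / 2)) *
          (cosh \<sigma> * 4 * (ln (pi / 2 + cos (\<theta> / 2)) - ln (cos (\<theta> / 2))))"
        using imag_kernel_integral_bounds(2)[OF \<sigma>] elim \<sigma> s s2 J c
        by (intro mult_mono mult_left_mono) auto
      finally show ?case .
    qed
  qed
  moreover have "(S \<longlongrightarrow> S pi) (at_left pi)"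
    using DERIV_isCont[OF D] by (simp add: isCont_def filterlim_at_split)
  ultimately have S_pi: "S pi = 0"
    using tendsto_unique trivial_limit_at_left_real by blast
  have "((\<lambda>\<theta>. (S \<theta> - S pi) / (\<theta> - pi)) \<longlongrightarrow> D) (at pi)"
    using D by (simp add: has_field_derivative_iff)
  then have "((\<lambda>\<theta>. (S \<theta> - S pi) / (\<theta> - pi)) \<longlongrightarrow> D) (at_left pi)"
    by (simp add: filterlim_at_split)
  then have D': "((\<lambda>\<theta>. - ((S \<theta> - S pi) / (\<theta> - pi))) \<longlongrightarrow> - D) (at_left pi)"
    by (rule tendsto_minus)
  have "filterlim (\<lambda>c. \<sigma> / sqrt 2 * (1 / 2) * (ln (pi / 2 + c) - ln c)) at_top (at_right 0)"
    using \<sigma> by real_asymp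
  from filterlim_compose[OF this c]
  have "filterlim (\<lambda>\<theta>. \<sigma> / sqrt 2 * (1 / 2) * (ln (pi / 2 + cos (\<theta> / 2)) - ln (cos (\<theta> / 2)))) at_top (at_left pi)" .
  \<comment> \<open>The sign makes the quotient positive to the left of \<open>pi\<close>. There
    \<open>sin \<theta> / (pi - \<theta>) >= 1 / 2\<close>, so the logarithmic lower bound survives
    the division.\<close>
  then have "filterlim (\<lambda>\<theta>. - ((S \<theta> - S pi) / (\<theta> - pi))) at_top (at_left pi)"
  proof (rule filterlim_at_top_mono)
    have "eventually (\<lambda>\<theta>. \<theta> > pi / 2) (at_left pi)"
      using eventually_at_left_real[of "pi / 2" pi] pi_gt_zero by (auto elim: eventually_mono)
    with ev show "\<forall>\<^sub>F \<theta> in at_left pi. \<sigma> / sqrt 2 * (1 / 2) * (ln (pi / 2 + cos (\<theta> / 2)) - ln (cos (\<theta> / 2)))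
        \<le> - ((S \<theta> - S pi) / (\<theta> - pi))"
    proof eventually_elim
      case (elim \<theta>)
      have c: "0 < cos (\<theta> / 2)" using elim by (intro cos_gt_zero) auto
      have "ln (cos (\<theta> / 2)) \<le> ln (pi / 2 + cos (\<theta> / 2))"
        using c by (subst ln_le_cancel_iff) (auto intro: add_pos_pos)
      then have L: "0 \<le> ln (pi / 2 + cos (\<theta> / 2)) - ln (cos (\<theta> / 2))" by simp
      have "(pi - \<theta>) / 2 \<le> sin (pi - \<theta>)" using elim by (intro half_le_sin) auto
      then have s: "1 / 2 \<le> sin \<theta> / (pi - \<theta>)" using elim by (simp add: field_simps)
      have "- ((S \<theta> - S pi) / (\<theta> - pi)) = \<sigma> / sqrt 2 * (sin \<theta> / (pi - \<theta>)) * imag_kernel_integral \<sigma> \<theta>"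
        using S_eq[of \<theta>] elim by (simp add: S_pi field_simps)
      moreover have "\<sigma> / sqrt 2 * (1 / 2) * (ln (pi / 2 + cos (\<theta> / 2)) - ln (cos (\<theta> / 2)))
          \<le> \<sigma> / sqrt 2 * (sin \<theta> / (pi - \<theta>)) * imag_kernel_integral \<sigma> \<theta>"
        using imag_kernel_integral_bounds(1)[OF \<sigma>] elim L \<sigma> s
        by (intro mult_mono mult_left_mono) auto
      ultimately show ?case by simp
    qed
  qed
  then show False
    using not_tendsto_and_filterlim_at_infinity[OF _ D'] filterlim_at_top_imp_at_infinity
      trivial_limit_at_left_real by blast
qed

text \<open>\<open>sinh\<close> vanishes at 0 with slope 1, so only the kernel integral at 0, which
  is \<open>pi / 2\<close>, contributes. Positivity makes prices positive for small \<open>T\<close>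
  and keeps a later square root off its branch cut.\<close>

lemma sabr_coeff_0: "sabr_coeff \<sigma> 0 = \<sigma> * pi / (2 * sqrt 2)"
proof -
  have 0: "(0::complex) \<in> strip" by (simp add: strip_def)
  have int: "(sabr_kernel_integral \<sigma> has_field_derivative deriv (sabr_kernel_integral \<sigma>) 0) (at 0)"
    by (rule holomorphic_derivI[OF holomorphic_on_sabr_kernel_integral open_strip 0])
  have "sabr_kernel_integral \<sigma> 0 = of_real (pi / 2)"
    by (simp add: sabr_kernel_integral_def ray_kernel_def sinc_fun_def scaleR_conv_of_real)
  moreover have "(sabr_g_complex \<sigma> has_field_derivative
     of_real (\<sigma> / sqrt 2) * sabr_kernel_integral \<sigma> 0) (at 0)"
    unfolding sabr_g_complex_def[abs_def] sinh_field_def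
    by (rule derivative_eq_intros int refl | simp)+
  ultimately have "deriv (sabr_g_complex \<sigma>) 0 = of_real (\<sigma> / sqrt 2 * (pi / 2))"
    by (simp only: DERIV_imp_deriv of_real_mult)
  then show ?thesis by (simp add: sabr_coeff_def)
qed

subsection \<open>Watson's lemma\<close>

text \<open>As a power series in \<open>u ^ 2\<close> the expansion converges at
  \<open>u = 2 < pi\<close>, that is at 4, hence absolutely at 1.\<close>

lemma sabr_coeff_abs_summable: "summable (\<lambda>k. \<bar>sabr_coeff \<sigma> k\<bar>)"
proof -
  have "summable (\<lambda>k. 1 / 2 * (sabr_coeff \<sigma> k * 2 ^ (2 * k + 1)))"
    using sabr_g_ray_sums[of 2 \<sigma>] pi_gt3 by (intro summable_mult) (auto simp: sums_iff)
  then have "summable (\<lambda>k. sabr_coeff \<sigma> k * 4 ^ k)"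
    by (simp add: power_mult)
  from powser_insidea[OF this, of 1] show ?thesis by simp
qed

lemma sabr_g_ray_remainder_small:
  assumes u: "0 \<le> u" "u \<le> 1"
  shows "\<bar>sabr_g_ray \<sigma> u - (\<Sum>k<N. sabr_coeff \<sigma> k * u ^ (2 * k + 1))\<bar>
    \<le> (\<Sum>k. \<bar>sabr_coeff \<sigma> k\<bar>) * u ^ (2 * N + 1)"
proof -
  let ?d = "sabr_coeff \<sigma>"
  have u3: "\<bar>u\<bar> < pi" using u pi_gt3 by linarith
  have sumd: "summable (\<lambda>k. \<bar>?d (k + N)\<bar>)"
    using summable_ignore_initial_segment[OF sabr_coeff_abs_summable] .
  have le: "norm (?d (k + N) * u ^ (2 * (k + N) + 1)) \<le> \<bar>?d (k + N)\<bar> * u ^ (2 * N + 1)" for k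
    using u by (auto simp: abs_mult intro!: mult_left_mono power_decreasing)
  have sumn: "summable (\<lambda>k. norm (?d (k + N) * u ^ (2 * (k + N) + 1)))"
    using le by (intro summable_comparison_test'[OF summable_mult2[OF sumd], where N = 0]) auto
  have "sabr_g_ray \<sigma> u - (\<Sum>k<N. ?d k * u ^ (2 * k + 1)) = (\<Sum>k. ?d (k + N) * u ^ (2 * (k + N) + 1))"
    using suminf_minus_initial_segment[OF sums_summable[OF sabr_g_ray_sums[OF u3, of \<sigma>]], of N]
      sums_unique[OF sabr_g_ray_sums[OF u3, of \<sigma>]] by simp
  also have "norm \<dots> \<le> (\<Sum>k. norm (?d (k + N) * u ^ (2 * (k + N) + 1)))"
    by (rule summable_norm[OF sumn])
  also have "\<dots> \<le> (\<Sum>k. \<bar>?d (k + N)\<bar> * u ^ (2 * N + 1))"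
    by (intro suminf_le le sumn summable_mult2 sumd)
  also have "\<dots> = (\<Sum>k. \<bar>?d (k + N)\<bar>) * u ^ (2 * N + 1)"
    using sumd by (rule suminf_mult2[symmetric])
  also have "\<dots> \<le> (\<Sum>k. \<bar>?d k\<bar>) * u ^ (2 * N + 1)"
  proof (rule mult_right_mono)
    show "(\<Sum>k. \<bar>?d (k + N)\<bar>) \<le> (\<Sum>k. \<bar>?d k\<bar>)"
      using suminf_split_initial_segment[OF sabr_coeff_abs_summable[of \<sigma>], of N]
        sum_nonneg[of "{..<N}" "\<lambda>k. \<bar>?d k\<bar>"] by simp
  qed (use u in auto)
  finally show ?thesis by simp
qed

text \<open>Up to 1 the Taylor tail gives the bound; beyond 1 the growth bound does, since there
  every lower power is below \<open>u ^ (2 * N + 1)\<close>. A global bound is what can be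
  integrated over the half-line.\<close>

lemma sabr_g_ray_remainder:
  assumes \<sigma>: "\<sigma> > 0"
  obtains K where "K \<ge> 0" "\<And>u. u > 0 \<Longrightarrow>
    \<bar>sabr_g_ray \<sigma> u - (\<Sum>k<N. sabr_coeff \<sigma> k * u ^ (2 * k + 1))\<bar> \<le> K * (u ^ (2 * N + 1) * exp u)"
proof
  let ?d = "sabr_coeff \<sigma>"
  define K where "K = (\<Sum>k. \<bar>?d k\<bar>) + \<sigma> * pi"
  have D: "(\<Sum>k. \<bar>?d k\<bar>) \<ge> 0" by (intro suminf_nonneg sabr_coeff_abs_summable) auto
  show "K \<ge> 0" using D \<sigma> by (simp add: K_def)
  fix u :: real assume u: "u > 0"
  have e1: "1 \<le> exp u" using u by simp
  show "\<bar>sabr_g_ray \<sigma> u - (\<Sum>k<N. ?d k * u ^ (2 * k + 1))\<bar> \<le> K * (u ^ (2 * N + 1) * exp u)"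
  proof (cases "u \<le> 1")
    case True
    have "(\<Sum>k. \<bar>?d k\<bar>) * u ^ (2 * N + 1) \<le> K * (u ^ (2 * N + 1) * exp u)"
      using D \<sigma> u e1 by (intro mult_mono) (auto simp: K_def)
    then show ?thesis using sabr_g_ray_remainder_small[of u \<sigma> N] u True by linarith
  next
    case False
    define E where "E = u ^ (2 * N + 1) * exp u"
    have p1: "1 \<le> u ^ (2 * N + 1)" using False by (intro one_le_power) simp
    have "\<bar>sabr_g_ray \<sigma> u\<bar> \<le> \<sigma> * pi * exp u" using abs_sabr_g_ray_le[OF \<sigma>, of u] u by simp
    also have "\<dots> \<le> \<sigma> * pi * E" unfolding E_def using \<sigma> p1 by (intro mult_left_mono) auto
    finally have g: "\<bar>sabr_g_ray \<sigma> u\<bar> \<le> \<sigma> * pi * E" .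
    have "\<bar>\<Sum>k<N. ?d k * u ^ (2 * k + 1)\<bar> \<le> (\<Sum>k<N. \<bar>?d k\<bar> * E)"
    proof (rule order_trans[OF sum_abs sum_mono])
      fix k assume "k \<in> {..<N}"
      then have "u ^ (2 * k + 1) \<le> u ^ (2 * N + 1)" using False by (intro power_increasing) auto
      also have "\<dots> \<le> E" using mult_left_mono[OF e1, of "u ^ (2 * N + 1)"] p1 unfolding E_def by simp
      finally show "\<bar>?d k * u ^ (2 * k + 1)\<bar> \<le> \<bar>?d k\<bar> * E"
        using u by (auto simp: abs_mult intro!: mult_left_mono)
    qed
    also have "\<dots> = (\<Sum>k<N. \<bar>?d k\<bar>) * E" by (simp add: sum_distrib_right)
    also have "\<dots> \<le> (\<Sum>k. \<bar>?d k\<bar>) * E"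
      using u by (intro mult_right_mono sum_le_suminf sabr_coeff_abs_summable) (auto simp: E_def)
    finally show ?thesis using g unfolding K_def E_def[symmetric] distrib_right by linarith
  qed
qed

text \<open>The standard odd Gaussian moment, rescaled by \<open>sqrt (2 * T)\<close>. The factor
  \<open>fact k\<close> is what makes the price expansion diverge.\<close>

lemma gaussian_odd_moment:
  assumes T: "T > 0"
  shows "has_bochner_integral lborel
    (\<lambda>u::real. indicator {0<..} u * (exp (- (u\<^sup>2) / (2 * T)) * u ^ (2 * k + 1))) (fact k * 2 ^ k * T ^ (k + 1))"
proof -
  define c where "c = sqrt (2 * T)"
  have c: "c > 0" "c\<^sup>2 = 2 * T" using T by (auto simp: c_def)
  \<comment> \<open>The endpoint 0 may be included because the odd power vanishes there.\<close>
  have ind: "indicat_real {0<..} u * (exp (- (u\<^sup>2) / (2 * T)) * u ^ (2 * k + 1))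
      = indicator {0..} u * (exp (- (u\<^sup>2) / (2 * T)) * u ^ (2 * k + 1))" for u
    by (auto simp: indicator_def)
  have "has_bochner_integral lborel (\<lambda>x::real. c ^ (2 * k + 1) * (indicator {0..} x *\<^sub>R (exp (-x\<^sup>2)*x^(2 * k + 1))))
      (c ^ (2 * k + 1) * (fact k / 2))"
    using gaussian_moment_odd_pos[of k] by (rule has_bochner_integral_mult_right)
  also have "(\<lambda>x::real. c ^ (2 * k + 1) * (indicator {0..} x *\<^sub>R (exp (-x\<^sup>2)*x^(2 * k + 1))))
     = (\<lambda>x. indicator {0..} (0 + c * x) * (exp (- ((0 + c * x)\<^sup>2) / (2 * T)) * (0 + c * x) ^ (2 * k + 1)))"
    using c T by (auto simp: indicator_def zero_le_mult_iff power_mult_distrib)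
  also have "c ^ (2 * k + 1) * (fact k / 2) = (fact k * 2 ^ k * T ^ (k + 1)) /\<^sub>R \<bar>c\<bar>"
  proof -
    have "c ^ (2 * k + 1) * c = (2 * T) ^ (k + 1)"
      using c(2) power_mult[of c 2 "k + 1"] by (simp add: power2_eq_square mult_ac)
    then have "c ^ (2 * k + 1) = (2 * T) ^ (k + 1) / c" using c by (simp add: field_simps)
    then show ?thesis using c by (simp add: power_mult_distrib field_simps)
  qed
  finally show ?thesis
    unfolding ind using c by (subst lborel_has_bochner_integral_real_affine_iff[where c = c and t = 0]) simp_all
qed

text \<open>Completing a square gives \<open>u <= 1 + u ^ 2 / 4\<close>, and for
  \<open>T <= 1\<close> half of the Gaussian exponent absorbs the quadratic term; the other half is
  a Gaussian at time \<open>2 * T\<close>.\<close>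

lemma exp_gauss_le:
  fixes u T :: real
  assumes "0 < T" "T \<le> 1"
  shows "exp (- (u\<^sup>2) / (2 * T)) * exp u \<le> exp 1 * exp (- (u\<^sup>2) / (2 * (2 * T)))"
proof -
  have "u \<le> 1 + u\<^sup>2 / 4"
    using zero_le_power2[of "u / 2 - 1"] by (simp add: power2_diff power_divide)
  moreover have "u\<^sup>2 / 4 \<le> u\<^sup>2 / (4 * T)" using assms by (intro divide_left_mono) auto
  ultimately have "u \<le> 1 + u\<^sup>2 / (4 * T)" by linarith
  moreover have "- (u\<^sup>2) / (2 * T) = - 2 * (u\<^sup>2 / (4 * T))" "- (u\<^sup>2) / (2 * (2 * T)) = - (u\<^sup>2 / (4 * T))"
    by simp_all
  ultimately have "- (u\<^sup>2) / (2 * T) + u \<le> 1 + - (u\<^sup>2) / (2 * (2 * T))" by linarith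
  then show ?thesis by (simp flip: exp_add)
qed

definition sabr_laplace :: "real \<Rightarrow> real \<Rightarrow> real" where
  "sabr_laplace \<sigma> T = (LBINT u:{0<..}. exp (- (u\<^sup>2) / (2 * T)) * sabr_g \<sigma> u)"

text \<open>Watson's lemma, with the remainder bounded by a Gaussian moment at time \<open>2 * T\<close>.\<close>
lemma sabr_laplace_remainder:
  assumes \<sigma>: "\<sigma> > 0"
  obtains K where "\<And>T. 0 < T \<Longrightarrow> T \<le> 1 \<Longrightarrow>
    \<bar>sabr_laplace \<sigma> T - (\<Sum>k<N. sabr_coeff \<sigma> k * (fact k * 2 ^ k * T ^ (k + 1)))\<bar> \<le> K * T ^ (N + 1)"
proof -
  let ?d = "sabr_coeff \<sigma>"
  define i where "i = indicat_real {0::real<..}"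
  define G where "G T u = exp (- (u\<^sup>2) / (2 * T))" for T u :: real
  have [measurable]: "i \<in> borel_measurable borel" by (simp add: i_def)
  have [measurable]: "G T \<in> borel_measurable borel" for T unfolding G_def[abs_def] by measurable
  have [measurable]: "sabr_g_ray \<sigma> \<in> borel_measurable borel"
    by (intro borel_measurable_continuous_onI continuous_on_sabr_g_ray)
  have lap: "sabr_laplace \<sigma> T = integral\<^sup>L lborel (\<lambda>u. i u * (G T u * sabr_g_ray \<sigma> u))" for T
    unfolding sabr_laplace_def set_lebesgue_integral_def i_def G_def
    by (intro Bochner_Integration.integral_cong) (auto simp: indicator_def sabr_g_eq_ray)
  have mom: "has_bochner_integral lborel (\<lambda>u. i u * (G T u * u ^ (2 * k + 1))) (fact k * 2 ^ k * T ^ (k + 1))"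
    if "0 < T" for T k
    unfolding i_def G_def by (rule gaussian_odd_moment[OF that])
  \<comment> \<open>Used twice: with \<open>r\<close> the integrand itself, for integrability, and
    with \<open>r\<close> the Taylor remainder, for the estimate.\<close>
  have bound: "integrable lborel (\<lambda>u. i u * (G T u * r u)) \<and>
      \<bar>integral\<^sup>L lborel (\<lambda>u. i u * (G T u * r u))\<bar> \<le> K * exp 1 * (fact n * 2 ^ n * (2 * T) ^ (n + 1))"
    if T: "0 < T" "T \<le> 1" and K: "K \<ge> 0" "\<And>u. u > 0 \<Longrightarrow> \<bar>r u\<bar> \<le> K * (u ^ (2 * n + 1) * exp u)"
      and [measurable]: "r \<in> borel_measurable borel" for T K n r
  proof -
    have "0 < 2 * T" using T by simp
    note m = has_bochner_integral_mult_right[OF mom[OF this, of n], of "K * exp 1"]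
    have le: "norm (i u * (G T u * r u)) \<le> K * exp 1 * (i u * (G (2 * T) u * u ^ (2 * n + 1)))" for u
    proof (cases "u > 0")
      case True
      have "G T u * \<bar>r u\<bar> \<le> G T u * (K * (u ^ (2 * n + 1) * exp u))"
        using K(2)[OF True] by (intro mult_left_mono) (auto simp: G_def)
      also have "\<dots> = K * u ^ (2 * n + 1) * (G T u * exp u)" by simp
      also have "\<dots> \<le> K * u ^ (2 * n + 1) * (exp 1 * G (2 * T) u)"
        unfolding G_def using exp_gauss_le[OF T, of u] K(1) True by (intro mult_left_mono) auto
      finally show ?thesis using True by (simp add: i_def abs_mult G_def mult_ac)
    qed (simp add: i_def)
    have int: "integrable lborel (\<lambda>u. i u * (G T u * r u))"
      using le by (intro Bochner_Integration.integrable_bound[OF integrable.intros[OF m]])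
        (auto intro: order_trans[OF _ abs_ge_self])
    have "norm (integral\<^sup>L lborel (\<lambda>u. i u * (G T u * r u))) \<le> integral\<^sup>L lborel (\<lambda>u. norm (i u * (G T u * r u)))"
      by (rule integral_norm_bound)
    also have "\<dots> \<le> integral\<^sup>L lborel (\<lambda>u. K * exp 1 * (i u * (G (2 * T) u * u ^ (2 * n + 1))))"
      using le by (intro integral_mono integrable_norm int integrable.intros[OF m]) auto
    also have "\<dots> = K * exp 1 * (fact n * 2 ^ n * (2 * T) ^ (n + 1))"
      by (rule has_bochner_integral_integral_eq[OF m])
    finally show ?thesis using int by simp
  qed
  \<comment> \<open>For \<open>N = 0\<close> the sum is empty, so this bounds
    \<open>sabr_g_ray\<close> itself.\<close>
  obtain K0 where K0: "K0 \<ge> 0" "\<And>u. u > 0 \<Longrightarrow>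
    \<bar>sabr_g_ray \<sigma> u - (\<Sum>k<0. ?d k * u ^ (2 * k + 1))\<bar> \<le> K0 * (u ^ (2 * 0 + 1) * exp u)"
    by (rule sabr_g_ray_remainder[OF \<sigma>, of 0]) blast
  obtain K where K: "K \<ge> 0" "\<And>u. u > 0 \<Longrightarrow>
    \<bar>sabr_g_ray \<sigma> u - (\<Sum>k<N. ?d k * u ^ (2 * k + 1))\<bar> \<le> K * (u ^ (2 * N + 1) * exp u)"
    by (rule sabr_g_ray_remainder[OF \<sigma>, of N]) blast
  show thesis
  proof (rule that[of "K * exp 1 * (fact N * 2 ^ N * 2 ^ (N + 1))"])
    fix T :: real assume T: "0 < T" "T \<le> 1"
    let ?r = "\<lambda>u. sabr_g_ray \<sigma> u - (\<Sum>k<N. ?d k * u ^ (2 * k + 1))"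
    have 0: "integrable lborel (\<lambda>u. i u * (G T u * sabr_g_ray \<sigma> u))"
      using bound[OF T K0(1), of "sabr_g_ray \<sigma>" 0] K0(2) by simp
    have "has_bochner_integral lborel
        (\<lambda>u. i u * (G T u * sabr_g_ray \<sigma> u) - (\<Sum>k<N. ?d k * (i u * (G T u * u ^ (2 * k + 1)))))
        (sabr_laplace \<sigma> T - (\<Sum>k<N. ?d k * (fact k * 2 ^ k * T ^ (k + 1))))"
      unfolding lap
      by (intro has_bochner_integral_diff has_bochner_integral_integrable 0 has_bochner_integral_sum
          has_bochner_integral_mult_right mom T has_bochner_integral_integral_eq)
    also have "(\<lambda>u. i u * (G T u * sabr_g_ray \<sigma> u) - (\<Sum>k<N. ?d k * (i u * (G T u * u ^ (2 * k + 1)))))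
       = (\<lambda>u. i u * (G T u * ?r u))"
      by (simp add: fun_eq_iff algebra_simps sum_distrib_left)
    finally have "sabr_laplace \<sigma> T - (\<Sum>k<N. ?d k * (fact k * 2 ^ k * T ^ (k + 1)))
       = integral\<^sup>L lborel (\<lambda>u. i u * (G T u * ?r u))"
      by (rule has_bochner_integral_integral_eq[symmetric])
    also have "\<bar>\<dots>\<bar> \<le> K * exp 1 * (fact N * 2 ^ N * (2 * T) ^ (N + 1))"
      using bound[OF T K(1), of ?r N] K(2) by simp
    finally show "\<bar>sabr_laplace \<sigma> T - (\<Sum>k<N. ?d k * (fact k * 2 ^ k * T ^ (k + 1)))\<bar>
       \<le> K * exp 1 * (fact N * 2 ^ N * 2 ^ (N + 1)) * T ^ (N + 1)"
      by (simp add: power_mult_distrib mult_ac)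
  qed
qed

subsection \<open>The error function\<close>

text \<open>For \<open>w > 0\<close> this is \<open>Erf (sqrt w) / sqrt w\<close>, with the
  integration rescaled to the unit interval so that it visibly extends to an entire function of
  \<open>w\<close>.\<close>

definition erf_quotient :: "real \<Rightarrow> real" where
  "erf_quotient w = 2 / sqrt pi * integral {0..1} (\<lambda>t. exp (- w * t\<^sup>2))"

definition erf_quotient_complex :: "complex \<Rightarrow> complex" where
  "erf_quotient_complex w = of_real (2 / sqrt pi) * integral {0..1} (\<lambda>t. exp (- w * of_real (t\<^sup>2)))"

lemma erf_quotient_complex_of_real: "erf_quotient_complex (of_real w) = of_real (erf_quotient w)"
proof -
  have int: "(\<lambda>t. exp (- w * t\<^sup>2)) integrable_on {0..1}"
    by (intro integrable_continuous_real continuous_intros)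
  have "exp (- complex_of_real w * of_real (t\<^sup>2)) = of_real (exp (- w * t\<^sup>2))" for t
    by (simp flip: exp_of_real)
  then show ?thesis
    using has_integral_of_real[OF integrable_integral[OF int], where 'b = complex]
    by (simp add: erf_quotient_complex_def erf_quotient_def integral_unique)
qed

lemma erf_quotient_complex_analytic: "erf_quotient_complex analytic_on A"
proof -
  have "(\<lambda>w. integral (cbox 0 1) (\<lambda>t. exp (- w * of_real (t\<^sup>2)))) holomorphic_on UNIV"
  proof (rule leibniz_rule_holomorphic)
    show "((\<lambda>w. exp (- w * complex_of_real (t\<^sup>2))) has_field_derivative
        - of_real (t\<^sup>2) * exp (- w * of_real (t\<^sup>2))) (at w within UNIV)" for w :: complex and t
      by (auto intro!: derivative_eq_intros)
    show "continuous_on (UNIV \<times> cbox 0 1) (\<lambda>(w, t). - of_real (t\<^sup>2) * exp (- w * complex_of_real (t\<^sup>2)))"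
      unfolding case_prod_beta by (intro continuous_intros)
    show "(\<lambda>t. exp (- w * complex_of_real (t\<^sup>2))) integrable_on cbox 0 1" for w
      by (intro integrable_continuous continuous_intros)
  qed auto
  then have "erf_quotient_complex holomorphic_on UNIV"
    unfolding erf_quotient_complex_def[abs_def] by (intro holomorphic_intros) simp
  then show ?thesis
    using analytic_on_open[of UNIV] analytic_on_subset by blast
qed

lemma erf_quotient_0: "erf_quotient 0 = 2 / sqrt pi"
  by (simp add: erf_quotient_def)

text \<open>A uniform lower bound, which bounds the volatility by the price and allows division by
  the quotient.\<close>

lemma erf_quotient_ge:
  assumes "w \<le> 1"
  shows "erf_quotient w \<ge> 2 / sqrt pi * exp (- 1)"
proof -
  have int: "(\<lambda>t. exp (- w * t\<^sup>2)) integrable_on {0..1}"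
    by (intro integrable_continuous_real continuous_intros)
  have "exp (- 1) \<le> exp (- w * t\<^sup>2)" if "t \<in> {0..1}" for t :: real
  proof -
    have "t\<^sup>2 \<le> 1" using that by (simp add: power_le_one)
    moreover have "w * t\<^sup>2 \<le> 1 * t\<^sup>2" using assms by (intro mult_right_mono) auto
    ultimately show ?thesis by simp
  qed
  then have "integral {0..1::real} (\<lambda>t. exp (- 1)) \<le> integral {0..1} (\<lambda>t. exp (- w * t\<^sup>2))"
    by (intro integral_le int) auto
  then show ?thesis unfolding erf_quotient_def by (intro mult_left_mono) auto
qed

lemma Erf_eq_integral:
  assumes "0 \<le> x"
  shows "Erf x = 2 / sqrt pi * integral {0..x} (\<lambda>t. exp (- (t\<^sup>2)))"
proof -
  have "set_integrable lborel {0..x} (\<lambda>t. exp (- (t\<^sup>2)))"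
    by (intro borel_integrable_atLeastAtMost' continuous_intros)
  then show ?thesis
    using interval_integral_eq_integral[OF assms] by (simp add: Erf_def zero_ereal_def)
qed

lemma Erf_eq_erf_quotient:
  assumes "0 \<le> x"
  shows "Erf x = x * erf_quotient (x\<^sup>2)"
proof (cases "x = 0")
  case True
  then show ?thesis using Erf_eq_integral[of 0] by simp
next
  case False
  then have x: "0 < x" using assms by simp
  have "(\<lambda>t. exp (- (t\<^sup>2))) integrable_on {0..x}"
    by (intro integrable_continuous_real continuous_intros)
  then have "((\<lambda>t. exp (- ((x * t)\<^sup>2))) has_integral (1 / \<bar>x\<bar>) *\<^sub>R integral {0..x} (\<lambda>t. exp (- (t\<^sup>2))))
      ((\<lambda>t. t / x) ` {0..x})"
    using x by (intro has_integral_stretch_real[where f = "\<lambda>t. exp (- (t\<^sup>2))"] integrable_integral) auto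
  moreover have "(\<lambda>t. t / x) ` {0..x} = {0..1}"
    using x by (simp add: image_divide_atLeastAtMost)
  ultimately have "integral {0..1} (\<lambda>t. exp (- (x\<^sup>2) * t\<^sup>2)) = integral {0..x} (\<lambda>t. exp (- (t\<^sup>2))) / x"
    using x by (simp add: integral_unique power_mult_distrib)
  then show ?thesis
    using x by (simp add: Erf_eq_integral erf_quotient_def)
qed

lemma Erf_strict_mono:
  assumes "0 \<le> x" "x < y"
  shows "Erf x < Erf y"
proof -
  have int: "(\<lambda>t. exp (- (t\<^sup>2))) integrable_on {a..b}" for a b :: real
    by (intro integrable_continuous_real continuous_intros)
  have "integral {x..y} (\<lambda>t. exp (- (y\<^sup>2))) \<le> integral {x..y} (\<lambda>t. exp (- (t\<^sup>2)))"
    using assms by (intro integral_le int) (auto intro!: power_mono)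
  moreover have "0 < integral {x..y} (\<lambda>t. exp (- (y\<^sup>2)))" using assms by simp
  moreover have "integral {0..x} (\<lambda>t. exp (- (t\<^sup>2))) + integral {x..y} (\<lambda>t. exp (- (t\<^sup>2)))
      = integral {0..y} (\<lambda>t. exp (- (t\<^sup>2)))"
    using assms by (intro Henstock_Kurzweil_Integration.integral_combine int) auto
  ultimately have "integral {0..x} (\<lambda>t. exp (- (t\<^sup>2))) < integral {0..y} (\<lambda>t. exp (- (t\<^sup>2)))"
    by linarith
  then show ?thesis using assms by (simp add: Erf_eq_integral divide_strict_right_mono)
qed

lemma Erf_0: "Erf 0 = 0"
  using Erf_eq_erf_quotient[of 0] by simp

text \<open>Values below \<open>Erf 1\<close> suffice because the scaled price tends to 0;
  \<open>x < 1\<close> later keeps the argument of \<open>erf_quotient\<close> below 1.\<close>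

lemma Erf_surj:
  assumes "0 < y" "y < Erf 1"
  shows "\<exists>x. 0 < x \<and> x < 1 \<and> Erf x = y"
proof -
  have "continuous_on {0..1} (\<lambda>x. 2 / sqrt pi * integral {0..x} (\<lambda>t. exp (- (t\<^sup>2))))"
    by (intro continuous_intros indefinite_integral_continuous_1 integrable_continuous_real) auto
  then have "continuous_on {0..1} Erf"
    by (rule continuous_on_eq) (simp add: Erf_eq_integral)
  moreover have "Erf 0 \<le> y" "y \<le> Erf 1" using assms Erf_0 by simp_all
  ultimately obtain x where x: "0 \<le> x" "x \<le> 1" "Erf x = y"
    using IVT'[of Erf 0 y 1] by auto
  then have "x \<noteq> 0" "x \<noteq> 1" using assms Erf_0 by auto
  with x show ?thesis by (intro exI[of _ x]) simp
qed

subsection \<open>The implied volatility\<close>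

text \<open>This is \<open>exp (T / 8)\<close> times the price divided by the spot and
  \<open>sqrt T\<close>. Without the exponential factor, the expansion comes straight from Watson's
  lemma.\<close>

definition sabr_D :: "real \<Rightarrow> real \<Rightarrow> real" where
  "sabr_D \<sigma> T = 2 / pi powr (3/2) * (sabr_laplace \<sigma> T / T)"

definition sabr_D_coeff :: "real \<Rightarrow> nat \<Rightarrow> real" where
  "sabr_D_coeff \<sigma> k = 2 / pi powr (3/2) * (sabr_coeff \<sigma> k * (fact k * 2 ^ k))"

lemma sabr_atm_call_eq:
  assumes "T > 0"
  shows "sabr_atm_call S \<sigma> T = S * (sqrt T * (exp (- T / 8) * sabr_D \<sigma> T))"
  using assms by (simp add: sabr_atm_call_def sabr_D_def sabr_laplace_def field_simps)

lemma sabr_D_expansion: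
  assumes \<sigma>: "\<sigma> > 0"
  shows "asymptotic_power_series_at_0_right (sabr_D \<sigma>) (sabr_D_coeff \<sigma>)"
  unfolding asymptotic_power_series_at_0_right_def
proof
  fix N
  let ?C = "2 / pi powr (3/2)"
  \<comment> \<open>\<open>Suc N\<close> terms, because the sum to be matched includes index
    \<open>N\<close>; dividing by \<open>T\<close> then lowers the error from
    \<open>T ^ (N + 2)\<close> to \<open>T ^ (N + 1)\<close>.\<close>
  obtain K where K: "\<And>T. 0 < T \<Longrightarrow> T \<le> 1 \<Longrightarrow>
    \<bar>sabr_laplace \<sigma> T - (\<Sum>k<Suc N. sabr_coeff \<sigma> k * (fact k * 2 ^ k * T ^ (k + 1)))\<bar> \<le> K * T ^ (Suc N + 1)"
    by (rule sabr_laplace_remainder[OF \<sigma>, of "Suc N"]) blast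
  show "(\<lambda>T. sabr_D \<sigma> T - (\<Sum>k\<le>N. sabr_D_coeff \<sigma> k * T ^ k)) \<in> O[at_right 0](\<lambda>T. T ^ (N + 1))"
  proof (rule bigoI[where c = "?C * K"])
    have "eventually (\<lambda>T::real. 0 < T \<and> T < 1) (at_right 0)"
      using eventually_at_right_real[of 0 "1::real"] by (auto elim: eventually_mono)
    then show "\<forall>\<^sub>F T in at_right 0. norm (sabr_D \<sigma> T - (\<Sum>k\<le>N. sabr_D_coeff \<sigma> k * T ^ k)) \<le> ?C * K * norm (T ^ (N + 1))"
    proof eventually_elim
      case (elim T)
      let ?R = "sabr_laplace \<sigma> T - (\<Sum>k<Suc N. sabr_coeff \<sigma> k * (fact k * 2 ^ k * T ^ (k + 1)))"
      have "(\<Sum>k\<le>N. sabr_D_coeff \<sigma> k * T ^ k) = ?C * ((\<Sum>k<Suc N. sabr_coeff \<sigma> k * (fact k * 2 ^ k * T ^ (k + 1))) / T)"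
        unfolding sum_divide_distrib sum_distrib_left lessThan_Suc_atMost
        using elim by (intro sum.cong) (auto simp: sabr_D_coeff_def)
      then have "sabr_D \<sigma> T - (\<Sum>k\<le>N. sabr_D_coeff \<sigma> k * T ^ k) = ?C * (?R / T)"
        by (simp only: sabr_D_def diff_divide_distrib right_diff_distrib)
      also have "norm \<dots> = ?C * (\<bar>?R\<bar> / T)"
      proof -
        have *: "norm (C * (R / T)) = C * (\<bar>R\<bar> / T)" if "C > 0" for C R :: real
          using elim that by (simp add: abs_mult)
        show ?thesis by (rule *) simp
      qed
      also have "\<dots> \<le> ?C * (K * T ^ (Suc N + 1) / T)"
        using K[of T] elim by (intro mult_left_mono divide_right_mono) auto
      also have "\<dots> = ?C * K * norm (T ^ (N + 1))" using elim by simp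
      finally show ?case .
    qed
  qed
qed

lemma sabr_D_tendsto:
  assumes \<sigma>: "\<sigma> > 0"
  shows "(sabr_D \<sigma> \<longlongrightarrow> sabr_D_coeff \<sigma> 0) (at_right 0)"
proof -
  have "agrees_upto (Suc 0) (\<lambda>T. of_real (sabr_D \<sigma> T)) (\<lambda>z. \<Sum>k\<le>0. of_real (sabr_D_coeff \<sigma> k) * z ^ k)"
    using sabr_D_expansion[OF \<sigma>] unfolding asymptotic_power_series_iff_agrees_upto by blast
  from agrees_upto_tendsto[OF this]
  have "((\<lambda>T. complex_of_real (sabr_D \<sigma> T)) \<longlongrightarrow> of_real (sabr_D_coeff \<sigma> 0)) (at_right 0)" by simp
  then show ?thesis by (simp only: tendsto_of_real_iff)
qed

lemma sabr_D_coeff_0_pos: "\<sigma> > 0 \<Longrightarrow> sabr_D_coeff \<sigma> 0 > 0"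
  by (simp add: sabr_D_coeff_def sabr_coeff_0)

text \<open>For small \<open>T\<close> the price over the spot lies between 0 and
  \<open>Erf 1\<close>, so it has a preimage under \<open>Erf\<close>, unique among nonnegative
  arguments by strict monotonicity; hence the description in \<open>sabr_implied_vol\<close>
  denotes. Cancelling \<open>sqrt T\<close> leaves the fixed-point equation.\<close>

lemma sabr_implied_vol_eventually:
  assumes \<sigma>: "\<sigma> > 0" and S: "S > 0"
  shows "\<forall>\<^sub>F T in at_right 0. T > 0 \<and> sabr_D \<sigma> T > 0 \<and> sabr_implied_vol S \<sigma> T > 0 \<and>
    (sabr_implied_vol S \<sigma> T)\<^sup>2 * T / 8 < 1 \<and>
    exp (- T / 8) * sabr_D \<sigma> T =
      sabr_implied_vol S \<sigma> T / (2 * sqrt 2) * erf_quotient ((sabr_implied_vol S \<sigma> T)\<^sup>2 * T / 8)"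
proof -
  have "((\<lambda>T. sqrt T * (exp (- T / 8) * sabr_D \<sigma> T)) \<longlongrightarrow> sqrt 0 * (exp (- 0 / 8) * sabr_D_coeff \<sigma> 0)) (at_right 0)"
    by (intro tendsto_intros sabr_D_tendsto[OF \<sigma>]) auto
  moreover have "0 < Erf 1" using Erf_strict_mono[of 0 1] Erf_0 by simp
  ultimately have "\<forall>\<^sub>F T in at_right 0. sqrt T * (exp (- T / 8) * sabr_D \<sigma> T) < Erf 1"
    by (intro order_tendstoD(2)) auto
  moreover have "\<forall>\<^sub>F T in at_right 0. sabr_D \<sigma> T > 0"
    by (rule order_tendstoD(1)[OF sabr_D_tendsto[OF \<sigma>] sabr_D_coeff_0_pos[OF \<sigma>]])
  moreover have "\<forall>\<^sub>F T in at_right 0. T > (0::real)"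
    by (simp add: eventually_at_right_less)
  ultimately show ?thesis
  proof eventually_elim
    case (elim T)
    let ?A = "exp (- T / 8) * sabr_D \<sigma> T"
    obtain x where x: "0 < x" "x < 1" "Erf x = sqrt T * ?A"
      using Erf_surj[of "sqrt T * ?A"] elim by auto
    define v where "v = 2 * sqrt 2 * x / sqrt T"
    have v: "v > 0" using x elim by (simp add: v_def)
    have vx: "v * sqrt T / (2 * sqrt 2) = x" using elim by (simp add: v_def)
    have "sabr_implied_vol S \<sigma> T = v"
      unfolding sabr_implied_vol_def
    proof (rule the_equality)
      show "v > 0 \<and> sabr_atm_call S \<sigma> T = S * Erf (v * sqrt T / (2 * sqrt 2))"
        using v x elim by (simp only: vx sabr_atm_call_eq)
      fix w assume w: "w > 0 \<and> sabr_atm_call S \<sigma> T = S * Erf (w * sqrt T / (2 * sqrt 2))"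
      define y where "y = w * sqrt T / (2 * sqrt 2)"
      have y: "0 \<le> y" using w elim by (simp add: y_def)
      have "Erf y = Erf x"
        using w S x(3) elim sabr_atm_call_eq[of T S \<sigma>] unfolding y_def by simp
      then have "y = x" using Erf_strict_mono[of x y] Erf_strict_mono[of y x] x y by force
      then show "w = v" using elim by (simp add: y_def v_def field_simps)
    qed
    moreover have x2: "x\<^sup>2 = v\<^sup>2 * T / 8"
      using elim unfolding vx[symmetric] by (simp add: power_divide power_mult_distrib)
    moreover have "x\<^sup>2 < 1" using x by (simp add: power_less_one_iff)
    moreover have "?A = v / (2 * sqrt 2) * erf_quotient (v\<^sup>2 * T / 8)"
    proof -
      have "sqrt T * ?A = x * erf_quotient (v\<^sup>2 * T / 8)"
        using Erf_eq_erf_quotient[of x] x unfolding x2 by simp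
      also have "x = sqrt T * (v / (2 * sqrt 2))" unfolding vx[symmetric] by simp
      finally have E: "sqrt T * ?A = sqrt T * (v / (2 * sqrt 2) * erf_quotient (v\<^sup>2 * T / 8))"
        by (simp only: mult.assoc)
      have Z: "sqrt T \<noteq> 0" using elim by simp
      show ?thesis by (rule mult_left_cancel[OF Z, THEN iffD1, OF E])
    qed
    ultimately show ?case using elim v by simp
  qed
qed

lemma agrees_upto_sabr_D:
  assumes "\<sigma> > 0"
  shows "\<exists>h. agrees_upto N (\<lambda>T. of_real (sabr_D \<sigma> T)) h"
proof -
  have "agrees_upto (Suc N) (\<lambda>T. of_real (sabr_D \<sigma> T)) (\<lambda>z. \<Sum>k\<le>N. of_real (sabr_D_coeff \<sigma> k) * z ^ k)"
    using sabr_D_expansion[OF assms] unfolding asymptotic_power_series_iff_agrees_upto by blast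
  then show ?thesis using agrees_upto_mono[of "Suc N" _ _ N] by fastforce
qed

text \<open>The lower bound on \<open>erf_quotient\<close> gives a constant multiple of
  \<open>sabr_D\<close> as upper bound, and \<open>sabr_D\<close> is bounded near 0. This starts the
  induction on the order.\<close>

lemma sabr_implied_vol_bigo_1:
  assumes \<sigma>: "\<sigma> > 0" and S: "S > 0"
  shows "(\<lambda>T. complex_of_real (sabr_implied_vol S \<sigma> T)) \<in> O[at_right 0](\<lambda>_. 1)"
proof -
  define B where "B = 2 * sqrt 2 / (2 / sqrt pi * exp (- 1))"
  have "\<forall>\<^sub>F T in at_right 0. norm (complex_of_real (sabr_implied_vol S \<sigma> T)) \<le> B * norm (complex_of_real (sabr_D \<sigma> T))"
    using sabr_implied_vol_eventually[OF \<sigma> S]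
  proof eventually_elim
    case (elim T)
    let ?v = "sabr_implied_vol S \<sigma> T"
    have "?v / (2 * sqrt 2) * (2 / sqrt pi * exp (- 1)) \<le> ?v / (2 * sqrt 2) * erf_quotient (?v\<^sup>2 * T / 8)"
      using elim by (intro mult_left_mono erf_quotient_ge) auto
    also have "\<dots> = exp (- T / 8) * sabr_D \<sigma> T" using elim by simp
    also have "\<dots> \<le> sabr_D \<sigma> T" using elim by (intro mult_left_le_one_le) auto
    finally show ?case using elim by (simp add: B_def field_simps)
  qed
  then have "(\<lambda>T. complex_of_real (sabr_implied_vol S \<sigma> T)) \<in> O[at_right 0](\<lambda>T. of_real (sabr_D \<sigma> T))"
    by (rule bigoI)
  also obtain h where "agrees_upto 0 (\<lambda>T. of_real (sabr_D \<sigma> T)) h" using agrees_upto_sabr_D[OF \<sigma>] by blast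
  then have "(\<lambda>T. complex_of_real (sabr_D \<sigma> T)) \<in> O[at_right 0](\<lambda>_. 1)" by (rule agrees_upto_bigo_1)
  finally show ?thesis .
qed

lemma analytic_exp_of_mult: "(\<lambda>z. exp (c * z)) analytic_on {0::complex}"
  by (intro analytic_intros)

text \<open>The equation \<open>v = 2 * sqrt 2 * A(T) / E(v\<^sup>2 * T / 8)\<close> improves the order of an approximation
  to \<open>v\<close> by one, because of the factor \<open>T\<close> on the right.\<close>
lemma agrees_upto_sabr_implied_vol:
  assumes \<sigma>: "\<sigma> > 0" and S: "S > 0"
  shows "\<exists>h. agrees_upto N (\<lambda>T. of_real (sabr_implied_vol S \<sigma> T)) h"
proof (induction N)
  \<comment> \<open>Order 0 asks only for boundedness, so the zero germ will do.\<close>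
  case 0
  show ?case
    using sabr_implied_vol_bigo_1[OF \<sigma> S] by (intro exI[of _ "\<lambda>_. 0"]) (simp add: agrees_upto_def)
next
  case (Suc N)
  let ?v = "sabr_implied_vol S \<sigma>"
  let ?E = erf_quotient_complex
  obtain h where h: "agrees_upto N (\<lambda>T. of_real (?v T)) h" using Suc by blast
  obtain d where d: "agrees_upto (Suc N) (\<lambda>T. of_real (sabr_D \<sigma> T)) d"
    using agrees_upto_sabr_D[OF \<sigma>] by blast
  have const: "agrees_upto M (\<lambda>_. c) (\<lambda>_. c)" for M c
    using agrees_upto_analytic[of "\<lambda>_. c" M] by simp
  \<comment> \<open>The volatility enters the right-hand side only here, known to order
    \<open>N\<close> but multiplied by \<open>T\<close>.\<close>
  have w: "agrees_upto (Suc N) (\<lambda>T. of_real T * (of_real (?v T) * of_real (?v T) * (1 / 8)))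
      (\<lambda>z. z * (h z * h z * (1 / 8)))"
    by (intro agrees_upto_times_T agrees_upto_mult h const)
  \<comment> \<open>The argument of the quotient tends to 0, so a nonzero value there makes the
    reciprocal analytic where it is needed.\<close>
  have E0: "?E 0 \<noteq> 0"
    using erf_quotient_complex_of_real[of 0] erf_quotient_0 by simp
  have R: "(\<lambda>w. inverse (?E w)) analytic_on {0}"
    using E0 by (intro analytic_on_inverse erf_quotient_complex_analytic) auto
  have R': "agrees_upto (Suc N) (\<lambda>T. inverse (?E (of_real T * (of_real (?v T) * of_real (?v T) * (1 / 8)))))
      (\<lambda>z. inverse (?E (z * (h z * h z * (1 / 8)))))"
    using agrees_upto_compose[OF _ w agrees_upto_tendsto[OF w], of "\<lambda>w. inverse (?E w)"] R by simp
  have e: "agrees_upto (Suc N) (\<lambda>T. exp (- 1 / 8 * of_real T)) (\<lambda>z. exp (- 1 / 8 * z))"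
    by (rule agrees_upto_analytic[OF analytic_exp_of_mult])
  have "agrees_upto (Suc N) (\<lambda>T. of_real (2 * sqrt 2) * (exp (- 1 / 8 * of_real T) * of_real (sabr_D \<sigma> T) *
       inverse (?E (of_real T * (of_real (?v T) * of_real (?v T) * (1 / 8))))))
     (\<lambda>z. of_real (2 * sqrt 2) * (exp (- 1 / 8 * z) * d z * inverse (?E (z * (h z * h z * (1 / 8))))))"
    by (intro agrees_upto_mult const e d R')
  then have "agrees_upto (Suc N) (\<lambda>T. of_real (?v T))
     (\<lambda>z. of_real (2 * sqrt 2) * (exp (- 1 / 8 * z) * d z * inverse (?E (z * (h z * h z * (1 / 8))))))"
  proof (rule agrees_upto_cong)
    show "\<forall>\<^sub>F T in at_right 0. of_real (2 * sqrt 2) * (exp (- 1 / 8 * of_real T) * of_real (sabr_D \<sigma> T) *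
       inverse (?E (of_real T * (of_real (?v T) * of_real (?v T) * (1 / 8))))) = complex_of_real (?v T)"
      using sabr_implied_vol_eventually[OF \<sigma> S]
    proof eventually_elim
      case (elim T)
      define q where "q = erf_quotient ((?v T)\<^sup>2 * T / 8)"
      have "0 < 2 / sqrt pi * exp (- 1)" by simp
      then have q: "q > 0" using erf_quotient_ge[of "(?v T)\<^sup>2 * T / 8"] elim unfolding q_def by linarith
      have "?E (of_real T * (of_real (?v T) * of_real (?v T) * (1 / 8))) = of_real q"
        unfolding q_def erf_quotient_complex_of_real[symmetric] by (simp add: power2_eq_square mult_ac)
      moreover have "exp (- 1 / 8 * complex_of_real T) = of_real (exp (- T / 8))"
        by (simp flip: exp_of_real)
      ultimately have "of_real (2 * sqrt 2) * (exp (- 1 / 8 * of_real T) * of_real (sabr_D \<sigma> T) *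
         inverse (?E (of_real T * (of_real (?v T) * of_real (?v T) * (1 / 8)))))
         = complex_of_real (2 * sqrt 2 * (exp (- T / 8) * sabr_D \<sigma> T * inverse q))"
        by (simp only: of_real_mult of_real_inverse)
      also have "2 * sqrt 2 * (exp (- T / 8) * sabr_D \<sigma> T * inverse q) = ?v T"
        using elim q unfolding q_def by simp
      finally show ?case .
    qed
  qed
  then show ?case by blast
qed

text \<open>By uniqueness the Taylor coefficients of \<open>h\<close> would be the
  \<open>sabr_D_coeff\<close>, hence of at most geometric growth. Dividing by
  \<open>fact n * 2 ^ n\<close> would make \<open>sabr_coeff\<close> summable against every
  \<open>r ^ n\<close>, contradicting the singularity at \<open>\<i> * pi\<close>.\<close>

lemma sabr_D_no_analytic_approximant:
  assumes \<sigma>: "\<sigma> > 0"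
  shows "\<not> (\<forall>N. agrees_upto N (\<lambda>T. of_real (sabr_D \<sigma> T)) h)"
proof
  assume h: "\<forall>N. agrees_upto N (\<lambda>T. of_real (sabr_D \<sigma> T)) h"
  define H where "H = fps_expansion h 0"
  have H: "h has_fps_expansion H"
    using h analytic_at_imp_has_fps_expansion_0 by (auto simp: agrees_upto_def H_def)
  have coeff: "fps_nth H n = of_real (sabr_D_coeff \<sigma> n)" for n
  proof -
    have "agrees_upto (Suc n) (\<lambda>T. of_real (sabr_D \<sigma> T)) (\<lambda>z. \<Sum>k\<le>n. of_real (sabr_D_coeff \<sigma> k) * z ^ k)"
      using sabr_D_expansion[OF \<sigma>] unfolding asymptotic_power_series_iff_agrees_upto by blast
    from agrees_upto_unique[OF h[rule_format] this H fps_sum_has_expansion, of n]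
    show ?thesis by simp
  qed
  have "0 < fps_conv_radius H" using H by (simp add: has_fps_expansion_def)
  then obtain s where s: "0 < ereal s" "ereal s < fps_conv_radius H" using ereal_dense2 by blast
  have "summable (\<lambda>n. fps_nth H n * of_real s ^ n)"
    using s by (intro summable_fps) auto
  then have "Bseq (\<lambda>n. fps_nth H n * of_real s ^ n)"
    using summable_LIMSEQ_zero convergentI convergent_imp_Bseq by blast
  then obtain B where B: "B > 0" "\<And>n. norm (fps_nth H n * of_real s ^ n) \<le> B" by (auto elim: BseqE)
  let ?C = "2 / pi powr (3/2)"
  have C: "?C > 0" by simp
  have "summable (\<lambda>n. sabr_coeff \<sigma> n * r ^ n)" for r :: real
  proof (rule summable_comparison_test'[where N = 0])
    show "summable (\<lambda>n. B / ?C * (inverse (fact n) * (\<bar>r\<bar> / (2 * s)) ^ n))"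
      using summable_exp by (rule summable_mult)
    fix n
    have "\<bar>sabr_D_coeff \<sigma> n\<bar> * s ^ n \<le> B"
      using B(2)[of n] s by (simp add: coeff norm_mult norm_power)
    then have "?C * (\<bar>sabr_coeff \<sigma> n\<bar> * (fact n * 2 ^ n)) * s ^ n \<le> B"
      by (simp add: sabr_D_coeff_def abs_mult)
    then have "\<bar>sabr_coeff \<sigma> n\<bar> \<le> B / (?C * (fact n * 2 ^ n) * s ^ n)"
      using s C by (subst pos_le_divide_eq) (auto simp: mult_ac)
    then have "\<bar>sabr_coeff \<sigma> n\<bar> * \<bar>r\<bar> ^ n \<le> B / (?C * (fact n * 2 ^ n) * s ^ n) * \<bar>r\<bar> ^ n"
      by (rule mult_right_mono) simp
    also have "\<dots> = B / ?C * (inverse (fact n) * (\<bar>r\<bar> / (2 * s)) ^ n)"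
    proof -
      have "B / (C * (x * y) * z) * w = B / C * (inverse x * (w / (y * z)))" for B C w x y z :: real
        by (simp only: divide_inverse inverse_mult_distrib mult_ac)
      then show ?thesis by (simp only: power_divide power_mult_distrib)
    qed
    finally show "norm (sabr_coeff \<sigma> n * r ^ n) \<le> B / ?C * (inverse (fact n) * (\<bar>r\<bar> / (2 * s)) ^ n)"
      by (simp add: abs_mult power_abs)
  qed
  then have "conv_radius (sabr_coeff \<sigma>) = \<infinity>"
    by (intro conv_radius_inftyI'') auto
  then show False using sabr_coeff_not_entire[OF \<sigma>] by simp
qed

text \<open>The squared pricing equation involves the volatility only through its square, so a germ
  for the variance ratio yields one for the square of \<open>sabr_D\<close>, and a square root
  yields one for \<open>sabr_D\<close> itself.\<close>

lemma sabr_implied_variance_no_analytic_approximant: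
  assumes \<sigma>: "\<sigma> > 0" and S: "S > 0"
  shows "\<not> (\<forall>N. agrees_upto N (\<lambda>T. of_real ((sabr_implied_vol S \<sigma> T / \<sigma>)\<^sup>2)) h)"
proof
  assume h: "\<forall>N. agrees_upto N (\<lambda>T. of_real ((sabr_implied_vol S \<sigma> T / \<sigma>)\<^sup>2)) h"
  let ?v = "sabr_implied_vol S \<sigma>"
  let ?E = erf_quotient_complex
  let ?f = "\<lambda>T. complex_of_real ((?v T / \<sigma>)\<^sup>2)"
  \<comment> \<open>This factor turns the variance ratio into \<open>v ^ 2 / 8\<close>.\<close>
  let ?c = "complex_of_real (\<sigma>\<^sup>2 / 8)"
  define W where "W z = ?c * h z" for z
  \<comment> \<open>The factor \<open>exp (1 / 4 * z)\<close> undoes the square of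
    \<open>exp (- T / 8)\<close>.\<close>
  define Q where "Q z = exp (1 / 4 * z) * (W z * (?E (z * W z) * ?E (z * W z)))" for z
  have const: "agrees_upto M (\<lambda>_. c) (\<lambda>_. c)" for M c
    using agrees_upto_analytic[of "\<lambda>_. c" M] by simp
  have w: "agrees_upto N (\<lambda>T. ?c * ?f T) W" for N
    unfolding W_def using h by (intro agrees_upto_mult const) auto
  have D2: "agrees_upto (Suc N) (\<lambda>T. of_real ((sabr_D \<sigma> T)\<^sup>2)) Q" for N
  proof -
    have Tw: "agrees_upto (Suc N) (\<lambda>T. of_real T * (?c * ?f T)) (\<lambda>z. z * W z)"
      by (intro agrees_upto_times_T w)
    have E: "agrees_upto (Suc N) (\<lambda>T. ?E (of_real T * (?c * ?f T))) (\<lambda>z. ?E (z * W z))"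
      by (rule agrees_upto_compose[OF erf_quotient_complex_analytic Tw agrees_upto_tendsto[OF Tw]])
    have e: "agrees_upto (Suc N) (\<lambda>T. exp (1 / 4 * of_real T)) (\<lambda>z. exp (1 / 4 * z))"
      by (rule agrees_upto_analytic[OF analytic_exp_of_mult])
    have "agrees_upto (Suc N) (\<lambda>T. exp (1 / 4 * of_real T) *
        (?c * ?f T * (?E (of_real T * (?c * ?f T)) * ?E (of_real T * (?c * ?f T))))) Q"
      unfolding Q_def by (intro agrees_upto_mult e w E)
    then show ?thesis
    proof (rule agrees_upto_cong)
      show "\<forall>\<^sub>F T in at_right 0. exp (1 / 4 * of_real T) *
        (?c * ?f T * (?E (of_real T * (?c * ?f T)) * ?E (of_real T * (?c * ?f T)))) = complex_of_real ((sabr_D \<sigma> T)\<^sup>2)"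
        using sabr_implied_vol_eventually[OF \<sigma> S]
      proof eventually_elim
        case (elim T)
        define q where "q = erf_quotient ((?v T)\<^sup>2 * T / 8)"
        have cf: "?c * ?f T = of_real ((?v T)\<^sup>2 / 8)"
          using \<sigma> by (simp add: power_divide flip: of_real_mult)
        have Eq: "?E (of_real T * of_real ((?v T)\<^sup>2 / 8)) = of_real q"
          unfolding q_def erf_quotient_complex_of_real[symmetric] by (simp add: mult_ac)
        have e: "exp (1 / 4 * complex_of_real T) = of_real (exp (T / 4))"
          by (simp flip: exp_of_real)
        have "sabr_D \<sigma> T = exp (T / 8) * (exp (- T / 8) * sabr_D \<sigma> T)"
          by (simp flip: mult.assoc exp_add)
        also have "\<dots> = exp (T / 8) * (?v T / (2 * sqrt 2) * q)" using elim by (simp add: q_def)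
        finally have "(sabr_D \<sigma> T)\<^sup>2 = (exp (T / 8))\<^sup>2 * ((?v T)\<^sup>2 / 8 * (q * q))"
          by (simp add: power_mult_distrib power_divide power2_eq_square)
        also have "(exp (T / 8))\<^sup>2 = exp (T / 4)"
          by (simp flip: exp_double)
        finally show ?case
          unfolding cf Eq e by (simp only: of_real_mult)
      qed
    qed
  qed
  \<comment> \<open>The positive limit puts \<open>Q 0\<close> off the branch cut of
    \<open>csqrt\<close>; since \<open>sabr_D\<close> is eventually positive, the principal root
    recovers it.\<close>
  define L where "L = (sabr_D_coeff \<sigma> 0)\<^sup>2"
  have L: "L > 0" using sabr_D_coeff_0_pos[OF \<sigma>] by (simp add: L_def)
  have "((\<lambda>T. complex_of_real ((sabr_D \<sigma> T)\<^sup>2)) \<longlongrightarrow> of_real L) (at_right 0)"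
    unfolding L_def by (intro tendsto_intros sabr_D_tendsto \<sigma>)
  with agrees_upto_tendsto[OF D2[of 0]] have Q0: "Q 0 = of_real L"
    using tendsto_unique trivial_limit_at_right_real by blast
  have "agrees_upto N (\<lambda>T. of_real (sabr_D \<sigma> T)) (\<lambda>z. csqrt (Q z))" for N
  proof -
    have "agrees_upto (Suc N) (\<lambda>T. csqrt (of_real ((sabr_D \<sigma> T)\<^sup>2))) (\<lambda>z. csqrt (Q z))"
    proof (rule agrees_upto_compose[OF _ D2 agrees_upto_tendsto[OF D2]])
      show "csqrt analytic_on {Q 0}"
        using L by (intro analytic_on_subset[OF analytic_on_csqrt]) (auto simp: Q0)
    qed
    then have "agrees_upto (Suc N) (\<lambda>T. of_real (sabr_D \<sigma> T)) (\<lambda>z. csqrt (Q z))"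
    proof (rule agrees_upto_cong)
      show "\<forall>\<^sub>F T in at_right 0. csqrt (of_real ((sabr_D \<sigma> T)\<^sup>2)) = complex_of_real (sabr_D \<sigma> T)"
        using sabr_implied_vol_eventually[OF \<sigma> S]
        by eventually_elim (subst csqrt_of_real, auto)
    qed
    then show ?thesis by (rule agrees_upto_mono) simp
  qed
  then show False using sabr_D_no_analytic_approximant[OF \<sigma>] by blast
qed

theorem mainTheorem1:
  fixes S\<^sub>0 \<sigma>\<^sub>0 :: real
  assumes "\<sigma>\<^sub>0 > 0" and "S\<^sub>0 > 0"
  shows "(\<exists>b. asymptotic_power_series_at_0_right (sabr_implied_vol S\<^sub>0 \<sigma>\<^sub>0) b
              \<and> conv_radius b = 0)
       \<and> (\<exists>c. asymptotic_power_series_at_0_right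
                 (\<lambda>T. (sabr_implied_vol S\<^sub>0 \<sigma>\<^sub>0 T / \<sigma>\<^sub>0)\<^sup>2) c
              \<and> conv_radius c = 0)"
proof -
  let ?v = "sabr_implied_vol S\<^sub>0 \<sigma>\<^sub>0"
  have square: "agrees_upto N (\<lambda>T. of_real ((?v T / \<sigma>\<^sub>0)\<^sup>2)) (\<lambda>z. of_real (1 / \<sigma>\<^sub>0\<^sup>2) * (h z * h z))"
    if "agrees_upto N (\<lambda>T. of_real (?v T)) h" for N h
  proof -
    have "agrees_upto N (\<lambda>T. of_real (1 / \<sigma>\<^sub>0\<^sup>2) * (of_real (?v T) * of_real (?v T)))
        (\<lambda>z. of_real (1 / \<sigma>\<^sub>0\<^sup>2) * (h z * h z))"
      using agrees_upto_analytic[of "\<lambda>_. of_real (1 / \<sigma>\<^sub>0\<^sup>2)" N] that by (intro agrees_upto_mult) simp_all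
    then show ?thesis
      by (simp add: power_divide power2_eq_square)
  qed
  obtain b where b: "asymptotic_power_series_at_0_right ?v b"
    using agrees_upto_imp_asymptotic_power_series agrees_upto_sabr_implied_vol[OF assms] by blast
  obtain c where c: "asymptotic_power_series_at_0_right (\<lambda>T. (?v T / \<sigma>\<^sub>0)\<^sup>2) c"
    using agrees_upto_imp_asymptotic_power_series[of "\<lambda>T. (?v T / \<sigma>\<^sub>0)\<^sup>2"]
      agrees_upto_sabr_implied_vol[OF assms] square by blast
  have "conv_radius c = 0"
    using convergent_asymptotic_power_series_imp_agrees_upto[OF c]
      sabr_implied_variance_no_analytic_approximant[OF assms] by blast
  \<comment> \<open>A germ for the volatility squares to one for the variance ratio, so both radii
    follow from the same non-existence result.\<close>
  moreover have "conv_radius b = 0"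
    using convergent_asymptotic_power_series_imp_agrees_upto[OF b] square
      sabr_implied_variance_no_analytic_approximant[OF assms] by blast
  ultimately show ?thesis using b c by blast
qed

end
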